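(* Let $G$ be a second-countable locally compact non-compact group with left Haar measure $\mu$ and identity $e$. Let $S\subset G$, $1\le p<+\infty$, let $\Gamma\subset\mathbb{C}$ be such that $\Gamma\setminus\{0\}$ is non-empty, and let $\omega$ be a locally $p$-integrable $S$-admissible weight on $G$. Then the following conditions are equivalent: (1) There is a $(\Gamma,S)$-dense vector in $L^p(G,\omega)$. (2) For every increasing sequence $(F_n)_{n\ge1}$ of compact subsets of $G$ of positive measure and for every sequence $(\delta_n)_{n\ge1}$ of positive numbers, there are sequences $(s_n)_{n\ge1}\subset S$, $(\lambda_n)_{n\ge1}\subset\Gamma\setminus\{0\}$ and a sequence of compact subsets $K_n\subset F_n$ ($n\ge 1$) such that the sets $s_n^{-1}F_n$ ($n\ge1$) are pairwise disjoint, $\mu(F_n\setminus K_n)<\delta_n$ for every $n\ge1$, and $$\sum_{n,k\ge0;\,n\neq k}\frac{|\lambda_n|^p}{|\lambda_k|^p}\,\|\omega\|_{p,s_ns_k^{-1}K_k}^p<+\infty,$$ where $s_0=e$, $\lambda_0=1$ and $K_0=\emptyset$. (3) For every $N\ge1$, there exist $N$ vectors $f_1,\dots,f_N\in L^p(G,\omega)$ such that the set $$\{\lambda(T_sf_1,\dots,T_sf_N):\ \lambda\in\Gamma,\ s\in S\}$$ is dense in the direct sum of $N$ copies of $L^p(G,\omega)$.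
   Context: A weight on $G$ is a positive measurable function $\omega:G\to(0,+\infty)$; it is locally $p$-integrable if $\int_K\omega^p\,d\mu<+\infty$ for every compact $K\subset G$. $L^p(G,\omega)$ is the space of measurable $f:G\to\mathbb{C}$ (modulo a.e. equality) with $\|f\|_{p,\omega}:=\left(\int_G|f(t)|^p\omega(t)^p\,d\mu(t)\right)^{1/p}<\infty$, with this norm. For $s\in G$, the left translation is $(T_sf)(t)=f(s^{-1}t)$. The weight $\omega$ is $S$-admissible if $M(s):=\operatorname{ess\,sup}_{t\in G}\omega(st)/\omega(t)<+\infty$ for all $s\in S$ (equivalently, $T_s$ is a bounded operator of $L^p(G,\omega)$ into itself for every $s\in S$). A vector $f\in L^p(G,\omega)$ is $(\Gamma,S)$-dense if $\{\lambda T_sf:\ \lambda\in\Gamma,\ s\in S\}$ is dense in $L^p(G,\omega)$. For a measurable function $f$ on $G$ and $K\subset G$, $\|f\|_{p,K}:=\left(\int_K|f(t)|^p\,d\mu(t)\right)^{1/p}$. *)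

theory Defs
  imports "HOL-Analysis.Analysis" "HOL-Probability.Essential_Supremum"
begin

text \<open>
  Topological groups are rendered by the class \<open>topological_group_add\<close>, whose group operation is
  written additively but is not assumed to be commutative: \<open>0\<close> is the identity, \<open>s + t\<close> the
  product $st$, \<open>- s\<close> the inverse $s^{-1}$, and \<open>s - t\<close> is $st^{-1}$.
\<close>

definition left_Haar_measure :: "'a::topological_group_add measure \<Rightarrow> bool" where
  "left_Haar_measure \<mu> \<longleftrightarrow>
     sets \<mu> = sets borel \<and>
     (\<forall>K. compact K \<longrightarrow> emeasure \<mu> K < \<infinity>) \<and>
     (\<forall>A\<in>sets borel. emeasure \<mu> A = (INF U\<in>{U. open U \<and> A \<subseteq> U}. emeasure \<mu> U)) \<and>
     (\<forall>U. open U \<longrightarrow> emeasure \<mu> U = (SUP K\<in>{K. compact K \<and> K \<subseteq> U}. emeasure \<mu> K)) \<and>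
     (\<forall>g. \<forall>A\<in>sets borel. emeasure \<mu> ((\<lambda>t. g + t) ` A) = emeasure \<mu> A) \<and>
     emeasure \<mu> UNIV \<noteq> 0"

definition weight :: "'a measure \<Rightarrow> ('a \<Rightarrow> real) \<Rightarrow> bool" where
  "weight \<mu> \<omega> \<longleftrightarrow> \<omega> \<in> borel_measurable \<mu> \<and> (\<forall>t. \<omega> t > 0)"

definition locally_p_integrable ::
    "'a::topological_space measure \<Rightarrow> real \<Rightarrow> ('a \<Rightarrow> real) \<Rightarrow> bool" where
  "locally_p_integrable \<mu> p \<omega> \<longleftrightarrow>
     (\<forall>K. compact K \<longrightarrow> set_integrable \<mu> K (\<lambda>t. \<omega> t powr p))"

definition admissible ::
    "'a::group_add measure \<Rightarrow> 'a set \<Rightarrow> ('a \<Rightarrow> real) \<Rightarrow> bool" where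
  "admissible \<mu> S \<omega> \<longleftrightarrow> (\<forall>s\<in>S. esssup \<mu> (\<lambda>t. ereal (\<omega> (s + t) / \<omega> t)) < \<infinity>)"

definition left_translate :: "'a::group_add \<Rightarrow> ('a \<Rightarrow> 'b) \<Rightarrow> 'a \<Rightarrow> 'b" where
  "left_translate s f = (\<lambda>t. f (- s + t))"

text \<open>
  The Bochner integral of a non-integrable function is \<open>0\<close>, so \<open>norm_on\<close> is the $p$-norm on \<open>K\<close>
  only if \<open>\<lambda>t. norm (f t) powr p\<close> is integrable on \<open>K\<close>.  This is the case for a locally
  $p$-integrable weight and compact \<open>K\<close>.
\<close>

definition norm_on ::
    "'a measure \<Rightarrow> real \<Rightarrow> 'a set \<Rightarrow> ('a \<Rightarrow> 'b::real_normed_vector) \<Rightarrow> real" where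
  "norm_on \<mu> p K f = (LINT t:K|\<mu>. norm (f t) powr p) powr (1 / p)"

definition Lp_funs :: "'a measure \<Rightarrow> real \<Rightarrow> ('a \<Rightarrow> real) \<Rightarrow> ('a \<Rightarrow> complex) set" where
  "Lp_funs \<mu> p \<omega> =
     {f \<in> borel_measurable \<mu>. integrable \<mu> (\<lambda>t. norm (f t) powr p * \<omega> t powr p)}"

definition Lp_norm :: "'a measure \<Rightarrow> real \<Rightarrow> ('a \<Rightarrow> real) \<Rightarrow> ('a \<Rightarrow> complex) \<Rightarrow> real" where
  "Lp_norm \<mu> p \<omega> f = (LINT t|\<mu>. norm (f t) powr p * \<omega> t powr p) powr (1 / p)"

definition Lp_class ::
    "'a measure \<Rightarrow> real \<Rightarrow> ('a \<Rightarrow> real) \<Rightarrow> ('a \<Rightarrow> complex) \<Rightarrow> ('a \<Rightarrow> complex) set" where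
  "Lp_class \<mu> p \<omega> f = {g \<in> Lp_funs \<mu> p \<omega>. AE t in \<mu>. g t = f t}"

definition Lp_space :: "'a measure \<Rightarrow> real \<Rightarrow> ('a \<Rightarrow> real) \<Rightarrow> ('a \<Rightarrow> complex) set set" where
  "Lp_space \<mu> p \<omega> = Lp_class \<mu> p \<omega> ` Lp_funs \<mu> p \<omega>"

definition Lp_dist ::
    "'a measure \<Rightarrow> real \<Rightarrow> ('a \<Rightarrow> real) \<Rightarrow> ('a \<Rightarrow> complex) set \<Rightarrow> ('a \<Rightarrow> complex) set \<Rightarrow> real" where
  "Lp_dist \<mu> p \<omega> F G = Lp_norm \<mu> p \<omega> (\<lambda>t. (SOME f. f \<in> F) t - (SOME g. g \<in> G) t)"

definition Lp_topology ::
    "'a measure \<Rightarrow> real \<Rightarrow> ('a \<Rightarrow> real) \<Rightarrow> ('a \<Rightarrow> complex) set topology" where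
  "Lp_topology \<mu> p \<omega> = Metric_space.mtopology (Lp_space \<mu> p \<omega>) (Lp_dist \<mu> p \<omega>)"

definition dense_in_space :: "'a topology \<Rightarrow> 'a set \<Rightarrow> bool" where
  "dense_in_space X A \<longleftrightarrow> A \<subseteq> topspace X \<and> X closure_of A = topspace X"

text \<open>
  Vectors of \<open>L\<^sup>p(G,\<omega>)\<close> are given by representatives \<open>f\<close>; their orbits consist of classes.
\<close>

definition dense_vector ::
    "'a::group_add measure \<Rightarrow> real \<Rightarrow> ('a \<Rightarrow> real) \<Rightarrow> complex set \<Rightarrow> 'a set \<Rightarrow> ('a \<Rightarrow> complex) \<Rightarrow> bool"
  where
  "dense_vector \<mu> p \<omega> \<Gamma> S f \<longleftrightarrow>
     f \<in> Lp_funs \<mu> p \<omega> \<and>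
     dense_in_space (Lp_topology \<mu> p \<omega>)
       {Lp_class \<mu> p \<omega> (\<lambda>t. c * left_translate s f t) | c s. c \<in> \<Gamma> \<and> s \<in> S}"

text \<open>
  On the direct sum of finitely many copies, every standard norm induces the product topology.
\<close>

definition dense_tuple ::
    "'a::group_add measure \<Rightarrow> real \<Rightarrow> ('a \<Rightarrow> real) \<Rightarrow> complex set \<Rightarrow> 'a set \<Rightarrow> nat
       \<Rightarrow> (nat \<Rightarrow> 'a \<Rightarrow> complex) \<Rightarrow> bool"
  where
  "dense_tuple \<mu> p \<omega> \<Gamma> S N f \<longleftrightarrow>
     (\<forall>i\<in>{1..N}. f i \<in> Lp_funs \<mu> p \<omega>) \<and>
     dense_in_space (product_topology (\<lambda>i. Lp_topology \<mu> p \<omega>) {1..N})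
       {(\<lambda>i\<in>{1..N}. Lp_class \<mu> p \<omega> (\<lambda>t. c * left_translate s (f i) t)) | c s. c \<in> \<Gamma> \<and> s \<in> S}"

subsection \<open>The distance is well defined and a metric\<close>

lemma powr_convex_nonneg:
  fixes p u v x y :: real
  assumes p: "1 \<le> p" and uv: "0 < u" "0 < v" "u + v = 1" and xy: "0 \<le> x" "0 \<le> y"
  shows "(u * x + v * y) powr p \<le> u * x powr p + v * y powr p"
proof -
  have scale: "(w * z) powr p \<le> w * z powr p" if "0 < w" "w \<le> 1" "0 \<le> z" for w z :: real
  proof -
    have "w powr p \<le> w powr 1" using that p by (intro powr_mono') auto
    then show ?thesis using that by (simp add: powr_mult mult_right_mono)
  qed
  consider "x = 0" | "y = 0" | "x > 0" "y > 0" using xy by linarith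
  then show ?thesis
  proof cases
    case 1 then show ?thesis using scale[of v y] uv xy p by simp
  next
    case 2 then show ?thesis using scale[of u x] uv xy p by simp
  next
    case 3
    have u: "u = 1 - v" using uv by simp
    show ?thesis
      using convex_onD[OF powr_convex[OF p], of v x y] 3 uv unfolding u by simp
  qed
qed

locale weighted_Lp =
  fixes \<mu> :: "'a measure" and p :: real and \<omega> :: "'a \<Rightarrow> real"
  assumes p: "1 \<le> p" and weight: "weight \<mu> \<omega>"
begin

lemma \<omega>_meas [measurable]: "\<omega> \<in> borel_measurable \<mu>" and \<omega>_pos: "\<omega> t > 0"
  using weight by (auto simp: weight_def)

lemma Lp_norm_nonneg: "0 \<le> Lp_norm \<mu> p \<omega> f"
  by (simp add: Lp_norm_def)

lemma Lp_norm_powr: "Lp_norm \<mu> p \<omega> f powr p = (LINT t|\<mu>. norm (f t) powr p * \<omega> t powr p)"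
  using p by (simp add: Lp_norm_def powr_powr)

lemma add_bound:
  assumes f: "f \<in> Lp_funs \<mu> p \<omega>" and g: "g \<in> Lp_funs \<mu> p \<omega>"
    and a: "0 < a" "Lp_norm \<mu> p \<omega> f \<le> a" and b: "0 < b" "Lp_norm \<mu> p \<omega> g \<le> b"
  shows "(\<lambda>t. f t + g t) \<in> Lp_funs \<mu> p \<omega>" "Lp_norm \<mu> p \<omega> (\<lambda>t. f t + g t) \<le> a + b"
proof -
  have [measurable]: "f \<in> borel_measurable \<mu>" "g \<in> borel_measurable \<mu>"
    using f g by (auto simp: Lp_funs_def)
  define F G H where "F = (\<lambda>t. norm (f t) powr p * \<omega> t powr p)"
    and "G = (\<lambda>t. norm (g t) powr p * \<omega> t powr p)"
    and "H = (\<lambda>t. norm (f t + g t) powr p * \<omega> t powr p)"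
  define c where "c = (a + b) powr p"
  define u v where "u = a / (a + b)" and "v = b / (a + b)"
  have c: "c > 0" and uv: "u > 0" "v > 0" "u + v = 1" using a(1) b(1)
    by (auto simp: u_def v_def c_def simp flip: add_divide_distrib)
  have FG: "integrable \<mu> F" "integrable \<mu> G" using f g by (auto simp: Lp_funs_def F_def G_def)
  define B where "B = (\<lambda>t. c * (u * (F t / a powr p) + v * (G t / b powr p)))"
  have intB: "integrable \<mu> B" unfolding B_def
    by (intro integrable_mult_right Bochner_Integration.integrable_add integrable_divide FG)
  have HB: "H t \<le> B t" for t
  proof -
    have "norm (f t + g t) powr p \<le> (norm (f t) + norm (g t)) powr p"
      using p by (intro powr_mono2 norm_triangle_ineq) auto
    also have "norm (f t) + norm (g t) = (a + b) * (u * (norm (f t) / a) + v * (norm (g t) / b))"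
    proof -
      have "(a + b) * u = a" "(a + b) * v = b" using a(1) b(1) by (simp_all add: u_def v_def)
      then have "(a + b) * (u * (norm (f t) / a) + v * (norm (g t) / b))
          = a * (norm (f t) / a) + b * (norm (g t) / b)"
        by (metis distrib_left mult.assoc)
      then show ?thesis using a(1) b(1) by simp
    qed
    also have "\<dots> powr p = c * (u * (norm (f t) / a) + v * (norm (g t) / b)) powr p"
      using a(1) b(1) uv by (simp add: c_def powr_mult)
    also have "\<dots> \<le> c * (u * (norm (f t) / a) powr p + v * (norm (g t) / b) powr p)"
      using c a(1) b(1) by (intro mult_left_mono powr_convex_nonneg p uv) auto
    also have "\<dots> = c * (u * (norm (f t) powr p / a powr p) + v * (norm (g t) powr p / b powr p))"
      using a(1) b(1) by (simp add: powr_divide)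
    finally have "H t \<le> c * (u * (norm (f t) powr p / a powr p)
        + v * (norm (g t) powr p / b powr p)) * \<omega> t powr p"
      unfolding H_def by (intro mult_right_mono) auto
    also have "\<dots> = B t" by (simp add: B_def F_def G_def algebra_simps)
    finally show ?thesis .
  qed
  have H0: "H t \<ge> 0" for t by (simp add: H_def)
  have H: "integrable \<mu> H"
    by (rule Bochner_Integration.integrable_bound[OF intB])
       (use HB H0 in \<open>auto simp: H_def intro!: AE_I2 order_trans[OF HB[unfolded H_def] abs_ge_self]\<close>)
  then show "(\<lambda>t. f t + g t) \<in> Lp_funs \<mu> p \<omega>" by (auto simp: Lp_funs_def H_def)
  have "integral\<^sup>L \<mu> F \<le> a powr p" "integral\<^sup>L \<mu> G \<le> b powr p"
    using Lp_norm_powr[of f] Lp_norm_powr[of g] a b p Lp_norm_nonneg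
    by (auto simp: F_def G_def intro!: powr_mono2 simp flip: Lp_norm_powr)
  then have FG1: "integral\<^sup>L \<mu> F / a powr p \<le> 1" "integral\<^sup>L \<mu> G / b powr p \<le> 1"
    using a(1) b(1) by (auto simp: divide_le_eq_1)
  have "integral\<^sup>L \<mu> H \<le> integral\<^sup>L \<mu> B" by (intro integral_mono H intB HB)
  also have "\<dots> = c * (u * (integral\<^sup>L \<mu> F / a powr p) + v * (integral\<^sup>L \<mu> G / b powr p))"
    unfolding B_def using FG by simp
  also have "\<dots> \<le> c * (u * 1 + v * 1)"
    using c uv by (intro mult_left_mono add_mono FG1) auto
  finally have "integral\<^sup>L \<mu> H \<le> (a + b) powr p" using uv by (simp add: c_def)
  then have "integral\<^sup>L \<mu> H powr (1/p) \<le> ((a + b) powr p) powr (1/p)"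
    using p H0 by (intro powr_mono2) auto
  then show "Lp_norm \<mu> p \<omega> (\<lambda>t. f t + g t) \<le> a + b"
    using p a(1) b(1) by (simp add: Lp_norm_def H_def powr_powr)
qed

lemma Lp_funs_add:
  assumes "f \<in> Lp_funs \<mu> p \<omega>" "g \<in> Lp_funs \<mu> p \<omega>"
  shows "(\<lambda>t. f t + g t) \<in> Lp_funs \<mu> p \<omega>"
  using add_bound(1)[OF assms, of "Lp_norm \<mu> p \<omega> f + 1" "Lp_norm \<mu> p \<omega> g + 1"]
    Lp_norm_nonneg[of f] Lp_norm_nonneg[of g] by simp

lemma Lp_norm_triangle:
  assumes "f \<in> Lp_funs \<mu> p \<omega>" "g \<in> Lp_funs \<mu> p \<omega>"
  shows "Lp_norm \<mu> p \<omega> (\<lambda>t. f t + g t) \<le> Lp_norm \<mu> p \<omega> f + Lp_norm \<mu> p \<omega> g"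
proof (rule field_le_epsilon)
  fix e :: real assume "e > 0"
  then show "Lp_norm \<mu> p \<omega> (\<lambda>t. f t + g t) \<le> Lp_norm \<mu> p \<omega> f + Lp_norm \<mu> p \<omega> g + e"
    using add_bound(2)[OF assms, of "Lp_norm \<mu> p \<omega> f + e/2" "Lp_norm \<mu> p \<omega> g + e/2"]
      Lp_norm_nonneg[of f] Lp_norm_nonneg[of g] by simp
qed

lemma Lp_funs_cmult: "f \<in> Lp_funs \<mu> p \<omega> \<Longrightarrow> (\<lambda>t. c * f t) \<in> Lp_funs \<mu> p \<omega>"
  by (auto simp: Lp_funs_def norm_mult powr_mult mult.assoc)

lemma Lp_funs_diff:
  assumes "f \<in> Lp_funs \<mu> p \<omega>" "g \<in> Lp_funs \<mu> p \<omega>"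
  shows "(\<lambda>t. f t - g t) \<in> Lp_funs \<mu> p \<omega>"
  using Lp_funs_add[OF assms(1) Lp_funs_cmult[OF assms(2), of "-1"]] by simp

lemma Lp_norm_eq_0_iff:
  assumes "f \<in> Lp_funs \<mu> p \<omega>"
  shows "Lp_norm \<mu> p \<omega> f = 0 \<longleftrightarrow> (AE t in \<mu>. f t = 0)"
proof -
  have "Lp_norm \<mu> p \<omega> f = 0 \<longleftrightarrow> (LINT t|\<mu>. norm (f t) powr p * \<omega> t powr p) = 0"
    by (simp add: Lp_norm_def)
  also have "\<dots> \<longleftrightarrow> (AE t in \<mu>. norm (f t) powr p * \<omega> t powr p = 0)"
    using assms by (intro integral_nonneg_eq_0_iff_AE) (auto simp: Lp_funs_def)
  also have "\<dots> \<longleftrightarrow> (AE t in \<mu>. f t = 0)"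
    using \<omega>_pos by (auto simp: less_imp_neq[THEN not_sym])
  finally show ?thesis .
qed

lemma Lp_norm_cong_AE:
  assumes "f \<in> Lp_funs \<mu> p \<omega>" "g \<in> Lp_funs \<mu> p \<omega>" "AE t in \<mu>. f t = g t"
  shows "Lp_norm \<mu> p \<omega> f = Lp_norm \<mu> p \<omega> g"
proof -
  have [measurable]: "f \<in> borel_measurable \<mu>" "g \<in> borel_measurable \<mu>"
    using assms by (auto simp: Lp_funs_def)
  show ?thesis unfolding Lp_norm_def
    by (intro arg_cong[where f="\<lambda>x. x powr (1/p)"] integral_cong_AE) (use assms in auto)
qed

lemma Lp_class_eq_iff:
  assumes "f \<in> Lp_funs \<mu> p \<omega>" "g \<in> Lp_funs \<mu> p \<omega>"
  shows "Lp_class \<mu> p \<omega> f = Lp_class \<mu> p \<omega> g \<longleftrightarrow> (AE t in \<mu>. f t = g t)"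
proof
  assume "Lp_class \<mu> p \<omega> f = Lp_class \<mu> p \<omega> g"
  moreover have "f \<in> Lp_class \<mu> p \<omega> f" using assms by (simp add: Lp_class_def)
  ultimately show "AE t in \<mu>. f t = g t" by (simp add: Lp_class_def)
next
  assume "AE t in \<mu>. f t = g t"
  then show "Lp_class \<mu> p \<omega> f = Lp_class \<mu> p \<omega> g"
    unfolding Lp_class_def by (auto elim: AE_mp)
qed

lemma Lp_class_some:
  assumes "f \<in> Lp_funs \<mu> p \<omega>"
  shows "(SOME g. g \<in> Lp_class \<mu> p \<omega> f) \<in> Lp_funs \<mu> p \<omega>"
    "AE t in \<mu>. (SOME g. g \<in> Lp_class \<mu> p \<omega> f) t = f t"
proof -
  have "f \<in> Lp_class \<mu> p \<omega> f" using assms by (simp add: Lp_class_def)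
  then have "(SOME g. g \<in> Lp_class \<mu> p \<omega> f) \<in> Lp_class \<mu> p \<omega> f"
    by (rule someI[where P = "\<lambda>g. g \<in> Lp_class \<mu> p \<omega> f"])
  then show "(SOME g. g \<in> Lp_class \<mu> p \<omega> f) \<in> Lp_funs \<mu> p \<omega>"
    "AE t in \<mu>. (SOME g. g \<in> Lp_class \<mu> p \<omega> f) t = f t" by (auto simp: Lp_class_def)
qed

lemma Lp_dist_class:
  assumes f: "f \<in> Lp_funs \<mu> p \<omega>" and g: "g \<in> Lp_funs \<mu> p \<omega>"
  shows "Lp_dist \<mu> p \<omega> (Lp_class \<mu> p \<omega> f) (Lp_class \<mu> p \<omega> g) = Lp_norm \<mu> p \<omega> (\<lambda>t. f t - g t)"
  unfolding Lp_dist_def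
proof (rule Lp_norm_cong_AE)
  show "AE t in \<mu>. (SOME h. h \<in> Lp_class \<mu> p \<omega> f) t - (SOME h. h \<in> Lp_class \<mu> p \<omega> g) t = f t - g t"
    using Lp_class_some(2)[OF f] Lp_class_some(2)[OF g] by eventually_elim simp
qed (intro Lp_funs_diff Lp_class_some f g)+

lemma Metric_space_Lp: "Metric_space (Lp_space \<mu> p \<omega>) (Lp_dist \<mu> p \<omega>)"
proof
  show "0 \<le> Lp_dist \<mu> p \<omega> x y" for x y by (simp add: Lp_dist_def Lp_norm_nonneg)
  show "Lp_dist \<mu> p \<omega> x y = Lp_dist \<mu> p \<omega> y x" for x y
    by (simp add: Lp_dist_def Lp_norm_def norm_minus_commute)
next
  fix x y assume "x \<in> Lp_space \<mu> p \<omega>" "y \<in> Lp_space \<mu> p \<omega>"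
  then obtain f g where fg: "f \<in> Lp_funs \<mu> p \<omega>" "g \<in> Lp_funs \<mu> p \<omega>"
    and xy: "x = Lp_class \<mu> p \<omega> f" "y = Lp_class \<mu> p \<omega> g" by (auto simp: Lp_space_def)
  show "Lp_dist \<mu> p \<omega> x y = 0 \<longleftrightarrow> x = y"
    using Lp_norm_eq_0_iff[OF Lp_funs_diff[OF fg]]
    by (simp add: xy Lp_dist_class[OF fg] Lp_class_eq_iff[OF fg])
next
  fix x y z assume "x \<in> Lp_space \<mu> p \<omega>" "y \<in> Lp_space \<mu> p \<omega>" "z \<in> Lp_space \<mu> p \<omega>"
  then obtain f g h where fg: "f \<in> Lp_funs \<mu> p \<omega>" "g \<in> Lp_funs \<mu> p \<omega>" "h \<in> Lp_funs \<mu> p \<omega>"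
    and xy: "x = Lp_class \<mu> p \<omega> f" "y = Lp_class \<mu> p \<omega> g" "z = Lp_class \<mu> p \<omega> h"
    by (auto simp: Lp_space_def)
  show "Lp_dist \<mu> p \<omega> x z \<le> Lp_dist \<mu> p \<omega> x y + Lp_dist \<mu> p \<omega> y z"
    using Lp_norm_triangle[OF Lp_funs_diff[OF fg(1,2)] Lp_funs_diff[OF fg(2,3)]]
    by (simp add: xy Lp_dist_class fg)
qed

end

end

theory Submission
  imports Defs
begin

text \<open>
  (1) implies (2): if \<open>f\<close> is dense, then $2\chi_F$ is approximated by \<open>c \<cdot> T\<^bsub>s\<^esub> f\<close> with \<open>s\<close>
  outside any prescribed compact set, so one can choose \<open>s n\<close>, \<open>l n\<close> inductively with
  \<open>l n \<cdot> T\<^bsub>s n\<^esub> f\<close> close to $2\chi_{F_n}$ and the sets $s_n^{-1}F_n$ disjoint. On \<open>K n\<close> one has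
  $|\lambda_n T_{s_n} f| \ge 1$, so $|f| \ge 1/|\lambda_k|$ on $s_k^{-1}K_k$, and the \<open>n\<close>-th row of the double
  series is at most the $p$-th power of the norm of \<open>l n \<cdot> T\<^bsub>s n\<^esub> f\<close> off \<open>F n\<close>.

  (2) implies (3): take a countable dense family of tuples of bounded functions with compact support,
  each listed infinitely often as $\varphi_j$, and set
  $f = \sum_j \lambda_{r_j}^{-1} T_{s_{r_j}}^{-1}(\varphi_j \chi_{K_{r_j}})$. The summands have disjoint supports;
  since the columns of the double series tend to zero, a sparse subsequence \<open>r\<close> absorbs the
  sup norms of the $\varphi_j$, and $\lambda_{r_j} T_{s_{r_j}} f - \varphi_j \to 0$.
\<close>

text \<open>The two main implications read the double series in different directions. Row
  \<open>n\<close> measures how far the \<open>n\<close>-th operator spreads the other pieces; row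
  \<open>0\<close>, where \<open>s 0 = 0\<close> and \<open>l 0 = 1\<close>, concerns the vector
  itself: it is bounded by the norm of \<open>f\<close> in (1) => (2), and it puts the constructed
  vectors into the space in (2) => (3). The sup norms of the targets do not occur in (2), so
  \<open>r\<close> can be chosen only after (2) has been applied, when the column sums are known.
  The obstacle in (1) => (2) is that density produces some \<open>s\<close> with no reason to avoid
  a given compact set; non-compactness helps because it yields compact sets of arbitrarily large
  Haar measure. Closeness in norm gives pointwise bounds only off a small set, hence
  \<open>K n\<close> inside \<open>F n\<close>, and the factor 2 in the target leaves a margin: an
  error of at most 1 keeps the modulus at least 1. Haar measure and the weighted measure are
  compared on compact sets, where each is absolutely continuous with respect to the other. (3) =>
  (1) is the case \<open>N = 1\<close>.\<close>

lemma density_absolutely_continuous_on: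
  fixes w :: "'a \<Rightarrow> real"
  assumes [measurable]: "w \<in> borel_measurable M" "E \<in> sets M"
    and fin: "emeasure (density M w) E < \<infinity>" and e: "e > 0"
  shows "\<exists>d>0. \<forall>A\<in>sets M. A \<subseteq> E \<longrightarrow> emeasure M A < ennreal d \<longrightarrow> emeasure (density M w) A < ennreal e"
proof -
  define N where "N = density M w"
  \<comment> \<open>Truncation: \<open>w\<close> takes finite values, so these sets decrease to the
    empty set and their weighted measure tends to 0, while on the rest of \<open>E\<close> the
    density is at most \<open>n\<close>.\<close>
  define B where "B n = {x\<in>E. w x > real n}" for n
  have B_sub: "B n = {x\<in>space M. x \<in> E \<and> w x > real n}" for n
    using sets.sets_into_space[OF assms(2)] by (auto simp: B_def)
  have [measurable]: "B n \<in> sets M" for n unfolding B_sub by measurable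
  have "(\<lambda>n. emeasure N (B n)) \<longlonglongrightarrow> emeasure N (\<Inter>n. B n)"
  proof (rule Lim_emeasure_decseq)
    show "decseq B" by (auto simp: decseq_def B_def)
    have "emeasure N (B n) \<le> emeasure N E" for n
      by (rule emeasure_mono) (auto simp: B_def N_def)
    then show "emeasure N (B n) \<noteq> \<infinity>" for n using fin unfolding N_def[symmetric]
      by (metis infinity_ennreal_def leD top.not_eq_extremum)
  qed (auto simp: N_def)
  moreover have "(\<Inter>n. B n) = {}"
    by (auto simp: B_def) (meson not_less real_arch_simple)
  ultimately have "(\<lambda>n. emeasure N (B n)) \<longlonglongrightarrow> 0" by simp
  then have "eventually (\<lambda>n. emeasure N (B n) < ennreal (e/4)) sequentially"
    using e by (intro order_tendstoD(2)) auto
  then obtain n where n: "emeasure N (B n) < ennreal (e/4)" by (auto dest: eventually_happens)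
  \<comment> \<open>The part off \<open>B n\<close> then costs at most \<open>e/2\<close>, and
    \<open>B n\<close> itself less than \<open>e/4\<close>, which keeps the total strictly below
    \<open>e\<close>.\<close>
  define d where "d = e / (2 * (real n + 1))"
  show ?thesis
  proof (intro exI[of _ d] conjI ballI impI)
    show "d > 0" using e by (simp add: d_def add_pos_nonneg)
    fix A assume A[measurable]: "A \<in> sets M" "A \<subseteq> E" "emeasure M A < ennreal d"
    have "emeasure N (A - B n) = (\<integral>\<^sup>+x. ennreal (w x) * indicator (A - B n) x \<partial>M)"
      unfolding N_def by (rule emeasure_density) auto
    also have "\<dots> \<le> (\<integral>\<^sup>+x. ennreal (real n + 1) * indicator A x \<partial>M)"
      using A(2) by (intro nn_integral_mono)
        (auto simp: B_def indicator_def ennreal_leI simp del: ennreal_plus)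
    also have "\<dots> = ennreal (real n + 1) * emeasure M A"
      by (simp add: nn_integral_cmult)
    also have "\<dots> \<le> ennreal (real n + 1) * ennreal d" using A(3) by (intro mult_left_mono) auto
    also have "\<dots> = ennreal ((real n + 1) * d)" by (rule ennreal_mult'[symmetric]) simp
    also have "(real n + 1) * d = e / 2" by (simp add: d_def field_simps)
    finally have *: "emeasure N (A - B n) \<le> ennreal (e/2)" .
    have "emeasure N A \<le> emeasure N ((A - B n) \<union> B n)"
      by (rule emeasure_mono) (auto simp: N_def)
    also have "\<dots> \<le> emeasure N (A - B n) + emeasure N (B n)"
      by (rule emeasure_subadditive) (auto simp: N_def)
    also have "\<dots> \<le> ennreal (e/2) + ennreal (e/4)"
      by (intro add_mono * less_imp_le n)
    also have "\<dots> < ennreal e" using e by (simp flip: ennreal_plus add: ennreal_less_iff)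
    finally show "emeasure (density M w) A < ennreal e" by (simp add: N_def)
  qed
qed

section \<open>Sums over disjoint sets, series in ennreal, subsequences\<close>

lemma sum_indicator_le_of_disjoint:
  fixes c :: "'i \<Rightarrow> ennreal"
  assumes "finite I" and "\<And>k j. k \<in> I \<Longrightarrow> j \<in> I \<Longrightarrow> t \<in> A k \<Longrightarrow> t \<in> A j \<Longrightarrow> k = j"
    and "\<And>k. k \<in> I \<Longrightarrow> t \<in> A k \<Longrightarrow> c k \<le> x"
  shows "(\<Sum>k\<in>I. c k * indicator (A k) t) \<le> x"
proof (cases "\<exists>k\<in>I. t \<in> A k")
  case True
  then obtain k where k: "k \<in> I" "t \<in> A k" by blast
  then have "(\<Sum>j\<in>I. c j * indicator (A j) t) = (\<Sum>j\<in>I. if j = k then c j else 0)"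
    using assms(2) by (intro sum.cong) (auto simp: indicator_def)
  also have "\<dots> = c k" using k assms(1) by simp
  finally show ?thesis using assms(3) k by simp
qed (auto intro!: sum_nonneg_eq_0_iff[THEN iffD2] simp: sum.neutral)

lemma sum_list_bounded_support:
  fixes h :: "'i \<Rightarrow> 'a \<Rightarrow> 'b::real_normed_vector" and E :: "nat \<Rightarrow> 'a set"
  assumes E: "incseq E"
    and h: "\<And>x. x \<in> set xs \<Longrightarrow> \<exists>B k. \<forall>t. norm (h x t) \<le> B \<and> (t \<notin> E k \<longrightarrow> h x t = 0)"
  shows "\<exists>B k. \<forall>t. norm (\<Sum>x\<leftarrow>xs. h x t) \<le> B \<and> (t \<notin> E k \<longrightarrow> (\<Sum>x\<leftarrow>xs. h x t) = 0)"
  using h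
proof (induction xs)
  case (Cons a xs)
  obtain B1 k1 where 1: "\<And>t. norm (h a t) \<le> B1" "\<And>t. t \<notin> E k1 \<Longrightarrow> h a t = 0"
    using Cons.prems[OF list.set_intros(1)] by blast
  obtain B2 k2 where 2: "\<And>t. norm (\<Sum>x\<leftarrow>xs. h x t) \<le> B2" "\<And>t. t \<notin> E k2 \<Longrightarrow> (\<Sum>x\<leftarrow>xs. h x t) = 0"
    using Cons.IH[OF Cons.prems[OF list.set_intros(2)]] by blast
  have "E k1 \<subseteq> E (max k1 k2)" "E k2 \<subseteq> E (max k1 k2)" using E by (auto simp: incseq_def)
  then have "t \<notin> E (max k1 k2) \<Longrightarrow> h a t = 0 \<and> (\<Sum>x\<leftarrow>xs. h x t) = 0" for t using 1 2 by blast
  moreover have "norm (h a t + (\<Sum>x\<leftarrow>xs. h x t)) \<le> B1 + B2" for t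
    using 1(1)[of t] 2(1)[of t] norm_triangle_ineq[of "h a t"] by (meson add_mono order_trans)
  ultimately show ?case by (intro exI[of _ "B1 + B2"] exI[of _ "max k1 k2"]) auto
qed (auto intro: exI[of _ 0])

lemma ennreal_suminf_tendsto_zero:
  fixes f :: "nat \<Rightarrow> ennreal"
  assumes "(\<Sum>n. f n) < \<infinity>"
  shows "f \<longlonglongrightarrow> 0"
proof -
  have fin: "f n = ennreal (enn2real (f n))" for n
    using ennreal_suminf_lessD[OF assms, of n] by simp
  have "(\<Sum>n. ennreal (enn2real (f n))) \<noteq> top" using assms fin by simp
  then have "summable (\<lambda>n. enn2real (f n))" by (rule summable_suminf_not_top[rotated]) simp
  then have "(\<lambda>n. ennreal (enn2real (f n))) \<longlonglongrightarrow> ennreal 0"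
    by (intro tendsto_ennrealI summable_LIMSEQ_zero)
  then show ?thesis using fin by simp
qed

lemma ennreal_suminf_swap:
  fixes f :: "nat \<Rightarrow> nat \<Rightarrow> ennreal"
  shows "(\<Sum>i. \<Sum>j. f i j) = (\<Sum>j. \<Sum>i. f i j)"
proof -
  have "(\<Sum>i. \<Sum>j. f i j) = (\<integral>\<^sup>+i. (\<Sum>j. f i j) \<partial>count_space UNIV)"
    by (simp add: nn_integral_count_space_nat)
  also have "\<dots> = (\<Sum>j. \<integral>\<^sup>+i. f i j \<partial>count_space UNIV)" by (rule nn_integral_suminf) simp
  finally show ?thesis by (simp add: nn_integral_count_space_nat)
qed

lemma ennreal_suminf_subsequence_le:
  fixes f :: "nat \<Rightarrow> ennreal"
  assumes "strict_mono r"
  shows "(\<Sum>j. f (r j)) \<le> (\<Sum>n. f n)"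
proof (rule suminf_le_const[OF summableI])
  fix m
  have "inj_on r {..<m}" using assms by (meson inj_on_subset strict_mono_imp_inj_on subset_UNIV)
  then have "(\<Sum>j<m. f (r j)) = sum f (r ` {..<m})" by (simp add: sum.reindex)
  also have "\<dots> \<le> (\<Sum>n. f n)" by (intro sum_le_suminf summableI) auto
  finally show "(\<Sum>j<m. f (r j)) \<le> (\<Sum>n. f n)" .
qed

lemma strict_mono_choice:
  assumes "\<And>j :: nat. eventually (P j) sequentially"
  shows "\<exists>r :: nat \<Rightarrow> nat. strict_mono r \<and> (\<forall>j. P j (r j))"
proof -
  obtain m where m: "\<And>j n. n \<ge> m j \<Longrightarrow> P j n"
    using assms unfolding eventually_sequentially by metis
  \<comment> \<open>The partial sum dominates the threshold \<open>m j\<close>; the summand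
    \<open>j\<close> makes \<open>r\<close> strictly increasing even if thresholds vanish.\<close>
  define r where "r j = j + (\<Sum>i\<le>j. m i)" for j
  have "strict_mono r" by (rule strict_mono_Suc_iff[THEN iffD2]) (simp add: r_def)
  moreover have "m j \<le> r j" for j
    using member_le_sum[of j "{..j}" m] by (simp add: r_def trans_le_add2)
  ultimately show ?thesis using m by blast
qed

lemma suminf_indicator_ge:
  fixes c :: "nat \<Rightarrow> ennreal"
  assumes "t \<in> A j"
  shows "c j \<le> (\<Sum>j. c j * indicator (A j) t)"
  using sum_le_suminf[OF summableI, of "{j}" "\<lambda>j. c j * indicator (A j) t"] assms by simp

section \<open>Translations and measures on the group\<close>

locale weighted_lc_group = weighted_Lp \<mu> p \<omega>
  for \<mu> :: "'a::{topological_group_add, t2_space, second_countable_topology} measure" and p \<omega> +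
  fixes S :: "'a set" and \<Gamma> :: "complex set"
  assumes locally_compact: "locally_compact_space (euclidean :: 'a topology)"
    and noncompact: "\<not> compact (UNIV :: 'a set)"
    and haar: "left_Haar_measure \<mu>"
    and locally_integrable: "locally_p_integrable \<mu> p \<omega>"
    and admissible: "admissible \<mu> S \<omega>"
begin

abbreviation "L \<equiv> Lp_funs \<mu> p \<omega>"
abbreviation "nrm \<equiv> Lp_norm \<mu> p \<omega>"

text \<open>The p-th power of the weighted norm becomes a plain integral of
  \<open>norm (f t) powr p\<close>, and the weight factors of the double series become measures of
  compact sets.\<close>

definition \<nu> :: "'a measure" where "\<nu> = density \<mu> (\<lambda>t. ennreal (\<omega> t powr p))"

lemma haarD:
  shows "sets \<mu> = sets borel"
    and "compact K \<Longrightarrow> emeasure \<mu> K < \<infinity>"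
    and "A \<in> sets borel \<Longrightarrow> emeasure \<mu> A = (INF U\<in>{U. open U \<and> A \<subseteq> U}. emeasure \<mu> U)"
    and "open U \<Longrightarrow> emeasure \<mu> U = (SUP K\<in>{K. compact K \<and> K \<subseteq> U}. emeasure \<mu> K)"
    and "A \<in> sets borel \<Longrightarrow> emeasure \<mu> ((\<lambda>t. g + t) ` A) = emeasure \<mu> A"
    and "emeasure \<mu> UNIV \<noteq> 0"
proof -
  note * = haar[unfolded left_Haar_measure_def]
  show "sets \<mu> = sets borel" by (rule *[THEN conjunct1])
  show "emeasure \<mu> K < \<infinity>" if "compact K"
    by (rule *[THEN conjunct2, THEN conjunct1, rule_format, OF that])
  show "emeasure \<mu> A = (INF U\<in>{U. open U \<and> A \<subseteq> U}. emeasure \<mu> U)" if "A \<in> sets borel"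
    by (rule *[THEN conjunct2, THEN conjunct2, THEN conjunct1, rule_format, OF that])
  show "emeasure \<mu> U = (SUP K\<in>{K. compact K \<and> K \<subseteq> U}. emeasure \<mu> K)" if "open U"
    by (rule *[THEN conjunct2, THEN conjunct2, THEN conjunct2, THEN conjunct1, rule_format, OF that])
  show "emeasure \<mu> ((\<lambda>t. g + t) ` A) = emeasure \<mu> A" if "A \<in> sets borel"
    by (rule *[THEN conjunct2, THEN conjunct2, THEN conjunct2, THEN conjunct2, THEN conjunct1, rule_format, OF that])
  show "emeasure \<mu> UNIV \<noteq> 0"
    by (rule *[THEN conjunct2, THEN conjunct2, THEN conjunct2, THEN conjunct2, THEN conjunct2])
qed

lemma sets_\<mu> [measurable_cong, simp]: "sets \<mu> = sets borel"
  by (fact haarD)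

lemma space_\<mu> [simp]: "space \<mu> = UNIV"
  using sets_eq_imp_space_eq[OF sets_\<mu>] by simp

lemma sets_\<nu> [measurable_cong, simp]: "sets \<nu> = sets borel"
  by (simp add: \<nu>_def)

lemma space_\<nu> [simp]: "space \<nu> = UNIV"
  by (simp add: \<nu>_def)

lemma compact_borel: "compact K \<Longrightarrow> K \<in> sets borel" for K :: "'a set"
  by (simp add: borel_compact)

lemma \<mu>_compact: "compact K \<Longrightarrow> emeasure \<mu> K < \<infinity>"
  by (fact haarD)

lemma translate_measurable [measurable]: "(\<lambda>t. g + t) \<in> borel_measurable borel" for g :: 'a
  by (intro borel_measurable_continuous_onI continuous_intros)

lemma \<omega>_borel [measurable]: "\<omega> \<in> borel_measurable borel"
  using \<omega>_meas by (simp cong: measurable_cong_sets)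

lemma Lp_borel: "f \<in> L \<Longrightarrow> f \<in> borel_measurable borel"
  by (simp add: Lp_funs_def cong: measurable_cong_sets)

lemma translate_image: "(\<lambda>t. g + t) ` A = {t. - g + t \<in> A}" for g :: 'a
  by (auto intro!: image_eqI[where x="- g + _"] simp: add.assoc[symmetric])

lemma borel_translate_image [measurable]: "A \<in> sets borel \<Longrightarrow> (\<lambda>t. g + t) ` A \<in> sets borel" for g :: 'a
  using measurable_sets[OF translate_measurable[of "- g"], of A] by (simp add: translate_image vimage_def)

lemma compact_translate_image: "compact A \<Longrightarrow> compact ((\<lambda>t. g + t) ` A)" for g :: 'a
  by (intro compact_continuous_image continuous_intros)

lemma \<mu>_translate: "A \<in> sets borel \<Longrightarrow> emeasure \<mu> ((\<lambda>t. g + t) ` A) = emeasure \<mu> A"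
  by (fact haarD)

lemma distr_translate: "distr \<mu> \<mu> (\<lambda>t. g + t) = \<mu>"
proof (rule measure_eqI)
  fix A assume "A \<in> sets (distr \<mu> \<mu> (\<lambda>t. g + t))"
  then have A: "A \<in> sets borel" by simp
  have "emeasure (distr \<mu> \<mu> (\<lambda>t. g + t)) A = emeasure \<mu> {t. g + t \<in> A}"
    using A by (subst emeasure_distr) (auto simp: vimage_def)
  also have "{t. g + t \<in> A} = (\<lambda>t. - g + t) ` A" by (simp add: translate_image)
  finally show "emeasure (distr \<mu> \<mu> (\<lambda>t. g + t)) A = emeasure \<mu> A" using \<mu>_translate[OF A] by simp
qed simp

lemma nn_integral_translate:
  assumes [measurable]: "f \<in> borel_measurable borel"
  shows "(\<integral>\<^sup>+t. f (g + t) \<partial>\<mu>) = (\<integral>\<^sup>+t. f t \<partial>\<mu>)"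
  using nn_integral_distr[of "\<lambda>t. g + t" \<mu> \<mu> f] by (simp add: distr_translate)

lemma nn_integral_\<nu>:
  "f \<in> borel_measurable borel \<Longrightarrow> (\<integral>\<^sup>+t. f t \<partial>\<nu>) = (\<integral>\<^sup>+t. ennreal (\<omega> t powr p) * f t \<partial>\<mu>)"
  unfolding \<nu>_def by (subst nn_integral_density) auto

lemma Lp_iff_nn:
  assumes [measurable]: "f \<in> borel_measurable borel"
  shows "f \<in> L \<longleftrightarrow> (\<integral>\<^sup>+t. ennreal (norm (f t) powr p) \<partial>\<nu>) < \<infinity>"
  by (simp add: Lp_funs_def integrable_iff_bounded nn_integral_\<nu> mult.commute ennreal_mult' abs_mult
      cong: measurable_cong_sets)

lemma nn_Lp_norm:
  assumes f: "f \<in> L"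
  shows "(\<integral>\<^sup>+t. ennreal (norm (f t) powr p) \<partial>\<nu>) = ennreal (nrm f powr p)"
proof -
  note [measurable] = Lp_borel[OF f]
  have "ennreal (nrm f powr p) = (\<integral>\<^sup>+t. ennreal (norm (f t) powr p * \<omega> t powr p) \<partial>\<mu>)"
    using f by (simp add: Lp_norm_powr Lp_funs_def nn_integral_eq_integral)
  then show ?thesis by (simp add: nn_integral_\<nu> mult.commute ennreal_mult')
qed

lemma Lp_norm_less_iff: "e > 0 \<Longrightarrow> nrm f < e \<longleftrightarrow> nrm f powr p < e powr p"
  using p Lp_norm_nonneg[of f] powr_less_mono2[of p "nrm f" e] powr_mono2[of p e "nrm f"]
  by (cases "nrm f < e") auto

lemma Lp_norm_lessI:
  assumes "f \<in> borel_measurable borel" "e > 0"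
    and "(\<integral>\<^sup>+t. ennreal (norm (f t) powr p) \<partial>\<nu>) < ennreal (e powr p)"
  shows "f \<in> L" "nrm f < e"
proof -
  show f: "f \<in> L" using assms by (auto simp: Lp_iff_nn intro: less_trans)
  show "nrm f < e"
    using assms(3) unfolding nn_Lp_norm[OF f] Lp_norm_less_iff[OF assms(2)] by (simp add: ennreal_less_iff)
qed

lemma Lp_norm_cmult: "nrm (\<lambda>t. c * f t) = norm c * nrm f"
  using p by (simp add: Lp_norm_def norm_mult powr_mult mult.assoc powr_powr)

text \<open>Local integrability excludes the default value 0 of the integral in
  \<open>norm_on\<close>, so the terms of the double series can be handled as genuine measures in
  ennreal.\<close>

lemma \<nu>_compact:
  assumes "compact K"
  shows "emeasure \<nu> K < \<infinity>" "norm_on \<mu> p K \<omega> powr p \<ge> 0"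
    "emeasure \<nu> K = ennreal (norm_on \<mu> p K \<omega> powr p)"
proof -
  note [measurable] = compact_borel[OF assms]
  have i: "set_integrable \<mu> K (\<lambda>t. \<omega> t powr p)"
    using locally_integrable assms by (auto simp: locally_p_integrable_def)
  have "(LINT t:K|\<mu>. norm (\<omega> t) powr p) \<ge> 0"
    by (simp add: set_lebesgue_integral_def)
  then have "norm_on \<mu> p K \<omega> powr p = (LINT t:K|\<mu>. norm (\<omega> t) powr p)"
    using p by (simp add: norm_on_def powr_powr)
  also have "\<dots> = (LINT t|\<mu>. indicator K t * \<omega> t powr p)"
    using \<omega>_pos by (simp add: set_lebesgue_integral_def abs_of_pos)
  also have "ennreal \<dots> = (\<integral>\<^sup>+t. ennreal (indicator K t * \<omega> t powr p) \<partial>\<mu>)"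
    using i by (subst nn_integral_eq_integral) (auto simp: set_integrable_def)
  also have "\<dots> = (\<integral>\<^sup>+t. ennreal (\<omega> t powr p) * indicator K t \<partial>\<mu>)"
    by (intro nn_integral_cong) (auto simp: indicator_def)
  also have "\<dots> = emeasure \<nu> K" unfolding \<nu>_def by (subst emeasure_density) auto
  finally show *: "emeasure \<nu> K = ennreal (norm_on \<mu> p K \<omega> powr p)" by simp
  then show "emeasure \<nu> K < \<infinity>" by simp
qed simp

text \<open>Positivity of the weight makes the density invertible, so absolute continuity on compact
  sets is available in both directions.\<close>

lemma \<mu>_eq_density_\<nu>: "\<mu> = density \<nu> (\<lambda>t. ennreal (inverse (\<omega> t powr p)))"
  unfolding \<nu>_def using \<omega>_pos
  by (subst density_density_eq) (auto simp: ennreal_mult'[symmetric] less_imp_neq[THEN not_sym] density_1)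

lemma \<nu>_small:
  assumes "compact E" "e > 0"
  shows "\<exists>d>0. \<forall>A\<in>sets borel. A \<subseteq> E \<longrightarrow> emeasure \<mu> A < ennreal d \<longrightarrow> emeasure \<nu> A < ennreal e"
  using density_absolutely_continuous_on[of "\<lambda>t. \<omega> t powr p" \<mu> E e] assms \<nu>_compact(1)[of E]
  unfolding \<nu>_def[symmetric] by (auto intro: compact_borel)

lemma \<mu>_small:
  assumes "compact E" "e > 0"
  shows "\<exists>d>0. \<forall>A\<in>sets borel. A \<subseteq> E \<longrightarrow> emeasure \<nu> A < ennreal d \<longrightarrow> emeasure \<mu> A < ennreal e"
  using density_absolutely_continuous_on[of "\<lambda>t. inverse (\<omega> t powr p)" \<nu> E e] assms \<mu>_compact[of E]
  unfolding \<mu>_eq_density_\<nu>[symmetric] by (auto intro: compact_borel)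

text \<open>Chebyshev's inequality bounds the weighted measure of the exceptional set, and
  \<open>\<mu>_small\<close> carries the bound over to Haar measure.\<close>

lemma norm_small_imp_small_in_measure:
  assumes E: "compact E" and ae: "a > 0" "e > 0"
  shows "\<exists>d>0. \<forall>h\<in>L. nrm h < d \<longrightarrow> emeasure \<mu> {t\<in>E. norm (h t) > a} < ennreal e"
proof -
  note [measurable] = compact_borel[OF E]
  obtain d where d: "d > 0" "\<And>A. A \<in> sets borel \<Longrightarrow> A \<subseteq> E \<Longrightarrow> emeasure \<nu> A < ennreal d \<Longrightarrow> emeasure \<mu> A < ennreal e"
    using \<mu>_small[OF E ae(2)] by blast
  show ?thesis
  proof (intro exI[of _ "(d * a powr p) powr (1/p)"] conjI ballI impI)
    show "(d * a powr p) powr (1/p) > 0" using d ae by simp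
    fix h assume h: "h \<in> L" "nrm h < (d * a powr p) powr (1/p)"
    note [measurable] = Lp_borel[OF h(1)]
    let ?A = "{t\<in>E. norm (h t) > a}"
    have [measurable]: "?A \<in> sets borel" by measurable
    have "ennreal (a powr p) * emeasure \<nu> ?A = (\<integral>\<^sup>+t. ennreal (a powr p) * indicator ?A t \<partial>\<nu>)"
      by (simp add: nn_integral_cmult)
    also have "\<dots> \<le> (\<integral>\<^sup>+t. ennreal (norm (h t) powr p) \<partial>\<nu>)"
      using ae p by (intro nn_integral_mono) (auto simp: indicator_def intro!: ennreal_leI powr_mono2)
    also have "\<dots> = ennreal (nrm h powr p)" by (rule nn_Lp_norm[OF h(1)])
    also have "\<dots> < ennreal (d * a powr p)"
    proof (rule ennreal_lessI)
      show "d * a powr p > 0" using d ae by simp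
      have "nrm h powr p < ((d * a powr p) powr (1/p)) powr p"
        using h(2) p Lp_norm_nonneg[of h] by (intro powr_less_mono2) auto
      then show "nrm h powr p < d * a powr p" using p d ae by (simp add: powr_powr)
    qed
    also have "\<dots> = ennreal (a powr p) * ennreal d" using d by (simp add: ennreal_mult' mult.commute)
    finally have "emeasure \<nu> ?A < ennreal d"
      by (meson linorder_not_le mult_left_mono zero_le)
    then show "emeasure \<mu> ?A < ennreal e" by (intro d) auto
  qed
qed

lemma indicator_in_Lp:
  assumes "compact K" "A \<in> sets borel" "A \<subseteq> K"
  shows "(\<lambda>t. c * indicator A t) \<in> L"
proof -
  note [measurable] = compact_borel[OF assms(1)] assms(2)
  have "emeasure \<nu> A \<le> emeasure \<nu> K" using assms by (intro emeasure_mono) auto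
  then have "emeasure \<nu> A < \<infinity>" using \<nu>_compact(1)[OF assms(1)] by (rule le_less_trans)
  moreover have "(\<integral>\<^sup>+t. ennreal (norm (indicator A t :: complex) powr p) \<partial>\<nu>) = (\<integral>\<^sup>+t. indicator A t \<partial>\<nu>)"
    using p by (intro nn_integral_cong) (auto simp: indicator_def)
  ultimately have "indicator A \<in> L" using assms by (subst Lp_iff_nn) auto
  then show ?thesis by (rule Lp_funs_cmult)
qed

text \<open>By left invariance the substitution of \<open>s + t\<close> for \<open>t\<close> moves
  the translation from \<open>f\<close> to the weight, where admissibility bounds
  \<open>\<omega> (s + t)\<close> by \<open>M * \<omega> t\<close> almost everywhere.\<close>

lemma translate_in_Lp:
  assumes f: "f \<in> L" and s: "s \<in> S"
  shows "left_translate s f \<in> L" "(\<lambda>t. c * left_translate s f t) \<in> L"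
proof -
  note [measurable] = Lp_borel[OF f]
  have "esssup \<mu> (\<lambda>t. ereal (\<omega> (s + t) / \<omega> t)) < \<infinity>"
    using admissible s by (auto simp: admissible_def)
  then obtain M where "esssup \<mu> (\<lambda>t. ereal (\<omega> (s + t) / \<omega> t)) \<le> ereal M"
    using ereal_dense2 less_imp_le by blast
  with esssup_AE[of "\<lambda>t. ereal (\<omega> (s + t) / \<omega> t)" \<mu>] have "AE t in \<mu>. \<omega> (s + t) / \<omega> t \<le> M"
    by (elim AE_mp) (auto intro!: AE_I2 dest: order_trans)
  then have AE: "AE t in \<mu>. \<omega> (s + t) \<le> M * \<omega> t"
    using \<omega>_pos by (elim AE_mp) (auto intro!: AE_I2 simp: field_simps)
  define h where "h t = ennreal (\<omega> t powr p) * ennreal (norm (left_translate s f t) powr p)" for t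
  have "(\<integral>\<^sup>+t. ennreal (norm (left_translate s f t) powr p) \<partial>\<nu>) = (\<integral>\<^sup>+t. h t \<partial>\<mu>)"
    unfolding h_def by (subst nn_integral_\<nu>) (auto simp: left_translate_def)
  also have "\<dots> = (\<integral>\<^sup>+t. h (s + t) \<partial>\<mu>)"
    by (rule nn_integral_translate[symmetric]) (auto simp: h_def left_translate_def)
  also have "\<dots> \<le> (\<integral>\<^sup>+t. ennreal (M powr p) * (ennreal (\<omega> t powr p) * ennreal (norm (f t) powr p)) \<partial>\<mu>)"
  proof (rule nn_integral_mono_AE, use AE in eventually_elim)
    fix t assume *: "\<omega> (s + t) \<le> M * \<omega> t"
    then have "M > 0" using \<omega>_pos[of t] \<omega>_pos[of "s+t"] by (meson less_le_trans zero_less_mult_pos2)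
    have "\<omega> (s + t) powr p \<le> M powr p * \<omega> t powr p"
      using * \<omega>_pos[of "s+t"] \<omega>_pos[of t] \<open>M > 0\<close> p powr_mono2[OF _ _ *, of p] by (simp add: powr_mult)
    then have "\<omega> (s + t) powr p * norm (f t) powr p \<le> M powr p * \<omega> t powr p * norm (f t) powr p"
      by (intro mult_right_mono) auto
    then show "h (s + t) \<le> ennreal (M powr p) * (ennreal (\<omega> t powr p) * ennreal (norm (f t) powr p))"
      unfolding h_def left_translate_def by (auto simp flip: ennreal_mult' add.assoc simp: mult.assoc intro!: ennreal_leI)
  qed
  also have "\<dots> = ennreal (M powr p) * (\<integral>\<^sup>+t. ennreal (norm (f t) powr p) \<partial>\<nu>)"
    by (simp add: nn_integral_cmult nn_integral_\<nu>)
  also have "\<dots> < \<infinity>" unfolding nn_Lp_norm[OF f] by (simp add: ennreal_mult_less_top)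
  finally show "left_translate s f \<in> L" by (subst Lp_iff_nn) (auto simp: left_translate_def)
  then show "(\<lambda>t. c * left_translate s f t) \<in> L" by (rule Lp_funs_cmult)
qed

section \<open>Compact sets and their translates in a non-compact group\<close>

lemma compact_sums: "compact A \<Longrightarrow> compact B \<Longrightarrow> compact ((\<lambda>(x, y). x + y) ` (A \<times> B))" for A B :: "'a set"
  by (intro compact_continuous_image compact_Times) (auto simp: split_beta intro!: continuous_intros)

lemma compact_negatives: "compact A \<Longrightarrow> compact (uminus ` A)" for A :: "'a set"
  by (intro compact_continuous_image continuous_intros)

lemma compact_quotients: "compact A \<Longrightarrow> compact B \<Longrightarrow> compact ((\<lambda>(x, y). x - y) ` (A \<times> B))" for A B :: "'a set"
  by (intro compact_continuous_image compact_Times) (auto simp: split_beta intro!: continuous_intros)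

lemma not_subset_compact: "compact K \<Longrightarrow> \<exists>g. g \<notin> K" for K :: "'a set"
  using noncompact by (metis UNIV_eq_I)

lemma positive_compact: "\<exists>K. compact K \<and> emeasure \<mu> K > 0"
proof -
  have "emeasure \<mu> UNIV = (SUP K\<in>{K. compact K \<and> K \<subseteq> UNIV}. emeasure \<mu> K)" "emeasure \<mu> UNIV \<noteq> 0"
    using haarD(4)[of UNIV] haarD(6) by auto
  then show ?thesis
    by (metis (mono_tags, lifting) SUP_eq_const SUP_least le_zero_eq mem_Collect_eq not_gr_zero)
qed

text \<open>A common point of \<open>g + A\<close> and \<open>B\<close> would make \<open>g\<close>
  a quotient of a point of \<open>B\<close> by a point of \<open>A\<close>; these quotients form a
  compact set, which cannot be the whole group.\<close>

lemma disjoint_translate: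
  fixes A B :: "'a set"
  assumes "compact A" "compact B"
  shows "\<exists>g. (\<lambda>t. g + t) ` A \<inter> B = {}"
proof -
  obtain g where g: "g \<notin> (\<lambda>(x, y). x - y) ` (B \<times> A)"
    using not_subset_compact[OF compact_quotients[OF assms(2,1)]] by blast
  have "g + a \<notin> B" if "a \<in> A" for a
    using g that by (auto simp: image_iff) (metis add_diff_cancel)
  then show ?thesis by blast
qed

text \<open>Disjoint translates of one compact set of positive measure are added one by one, each
  contributing the same amount.\<close>

lemma large_compact: "\<exists>A. compact A \<and> emeasure \<mu> A > ennreal m"
proof -
  obtain K where K: "compact K" "emeasure \<mu> K > 0" using positive_compact by blast
  have ex: "\<exists>A. compact A \<and> emeasure \<mu> A \<ge> of_nat n * emeasure \<mu> K" for n
  proof (induction n)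
    case 0 show ?case by (intro exI[of _ "{}"]) auto
  next
    case (Suc n)
    then obtain A where A: "compact A" "emeasure \<mu> A \<ge> of_nat n * emeasure \<mu> K" by blast
    obtain g where g: "(\<lambda>t. g + t) ` K \<inter> A = {}" using disjoint_translate[OF K(1) A(1)] by blast
    note [measurable] = compact_borel[OF A(1)] compact_borel[OF K(1)]
    have "emeasure \<mu> ((\<lambda>t. g + t) ` K \<union> A) = emeasure \<mu> K + emeasure \<mu> A"
      using g by (subst plus_emeasure[symmetric]) (auto simp: \<mu>_translate)
    then have "emeasure \<mu> ((\<lambda>t. g + t) ` K \<union> A) \<ge> of_nat (Suc n) * emeasure \<mu> K"
      using A(2) by (simp add: distrib_right add_left_mono)
    then show ?case using A(1) compact_translate_image[OF K(1), of g] by blast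
  qed
  obtain k where k: "emeasure \<mu> K = ennreal k" "k > 0"
    using K(2) \<mu>_compact[OF K(1)] by (cases "emeasure \<mu> K") (auto simp: ennreal_less_zero_iff)
  obtain n where n: "max m 0 < real n * k" using k(2) reals_Archimedean3 by blast
  then have "ennreal m < ennreal (real n * k)" by (intro ennreal_lessI) auto
  also have "\<dots> = of_nat n * emeasure \<mu> K" by (simp add: k ennreal_mult' ennreal_of_nat_eq_real_of_nat)
  finally show ?thesis using ex[of n] by (metis less_le_trans)
qed

section \<open>Orbits of a dense vector\<close>

lemma dense_vectorD:
  assumes "dense_vector \<mu> p \<omega> \<Gamma> S f"
  shows "f \<in> L"
    and "g \<in> L \<Longrightarrow> e > 0 \<Longrightarrow> \<exists>c\<in>\<Gamma>. \<exists>s\<in>S. nrm (\<lambda>t. c * left_translate s f t - g t) < e"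
proof -
  interpret M: Metric_space "Lp_space \<mu> p \<omega>" "Lp_dist \<mu> p \<omega>" by (rule Metric_space_Lp)
  show f: "f \<in> L" using assms by (simp add: dense_vector_def)
  assume g: "g \<in> L" and e: "e > 0"
  let ?O = "{Lp_class \<mu> p \<omega> (\<lambda>t. c * left_translate s f t) | c s. c \<in> \<Gamma> \<and> s \<in> S}"
  have "Lp_class \<mu> p \<omega> g \<in> Lp_space \<mu> p \<omega>" using g by (auto simp: Lp_space_def)
  then have "Lp_class \<mu> p \<omega> g \<in> M.mtopology closure_of ?O"
    using assms by (simp add: dense_vector_def dense_in_space_def Lp_topology_def)
  then obtain c s where cs: "c \<in> \<Gamma>" "s \<in> S"
    and "Lp_dist \<mu> p \<omega> (Lp_class \<mu> p \<omega> g) (Lp_class \<mu> p \<omega> (\<lambda>t. c * left_translate s f t)) < e"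
    using e unfolding M.metric_closure_of by fastforce
  then have "nrm (\<lambda>t. c * left_translate s f t - g t) < e"
    by (simp add: Lp_dist_class translate_in_Lp f g Lp_norm_def norm_minus_commute)
  then show "\<exists>c\<in>\<Gamma>. \<exists>s\<in>S. nrm (\<lambda>t. c * left_translate s f t - g t) < e" using cs by blast
qed

text \<open>
  Translations by elements of \<open>C\<close> are ruled out by perturbing the target. Some orbit point shows that
  \<open>\<bar>f\<bar>\<close> takes values with ratio at least \<open>2\<close> on a set \<open>A' \<union> B'\<close> too large to be covered by
  $C^{-1}F$. Add to $2\chi_F$ a small constant multiple of the indicator of $C(A'\cup B') \setminus F$:
  an orbit point with \<open>s \<in> C\<close> close to the sum would make \<open>\<bar>f\<bar>\<close> nearly constant on most of
  $(A'\cup B') \setminus C^{-1}F$.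
\<close>

lemma dense_vector_escapes_compact:
  assumes dv: "dense_vector \<mu> p \<omega> \<Gamma> S f" and C: "compact C" and F: "compact F" and e: "e > 0"
  shows "\<exists>c\<in>\<Gamma>. \<exists>s\<in>S. s \<notin> C \<and> nrm (\<lambda>t. c * left_translate s f t - 2 * indicator F t) < e"
proof -
  note f = dense_vectorD(1)[OF dv]
  note [measurable] = Lp_borel[OF f] compact_borel[OF F]
  \<comment> \<open>The set C^{-1}F: a point outside \<open>D\<close> is not moved into
    \<open>F\<close> by any element of \<open>C\<close>.\<close>
  define D where "D = (\<lambda>(x, y). x + y) ` (uminus ` C \<times> F)"
  have D: "compact D" unfolding D_def by (intro compact_sums compact_negatives C F)
  define m where "m = enn2real (emeasure \<mu> D)"
  have m: "emeasure \<mu> D = ennreal m" "m \<ge> 0"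
    using \<mu>_compact[OF D] by (auto simp: m_def)
  \<comment> \<open>The surplus 1 over the measure of \<open>D\<close> pays for two exceptional sets
    of measure below 1/2 each.\<close>
  obtain A where A: "compact A" "emeasure \<mu> A > ennreal (m + 1)" using large_compact by blast
  obtain g where g: "(\<lambda>t. g + t) ` A \<inter> A = {}" using disjoint_translate[OF A(1) A(1)] by blast
  define B where "B = (\<lambda>t. g + t) ` A"
  have B: "compact B" "emeasure \<mu> B > ennreal (m + 1)" "A \<inter> B = {}"
    using A g by (auto simp: B_def compact_translate_image \<mu>_translate compact_borel)
  note [measurable] = compact_borel[OF A(1)] compact_borel[OF B(1)]
  \<comment> \<open>With target the indicator of \<open>A\<close>, tolerance 1/3 leaves modulus at
    least 2/3 on \<open>A\<close> and at most 1/3 on \<open>B\<close>, up to a small set: this is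
    the ratio 2.\<close>
  obtain d1 where d1: "d1 > 0"
    "\<And>h. h \<in> L \<Longrightarrow> nrm h < d1 \<Longrightarrow> emeasure \<mu> {t\<in>A \<union> B. norm (h t) > 1/3} < ennreal (1/2)"
    using norm_small_imp_small_in_measure[OF compact_Un[OF A(1) B(1)], of "1/3" "1/2"] by auto
  have indA: "(\<lambda>t. 1 * indicator A t) \<in> L" by (rule indicator_in_Lp[OF A(1)]) auto
  obtain c' s' where cs': "c' \<in> \<Gamma>" "s' \<in> S"
    "nrm (\<lambda>t. c' * left_translate s' f t - 1 * indicator A t) < d1"
    using dense_vectorD(2)[OF dv indA d1(1)] by blast
  define Bad1 where "Bad1 = {t\<in>A \<union> B. norm (c' * left_translate s' f t - 1 * indicator A t) > 1/3}"
  have Bad1: "emeasure \<mu> Bad1 < ennreal (1/2)" unfolding Bad1_def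
    by (rule d1) (auto intro!: Lp_funs_diff translate_in_Lp f cs' indA[simplified] simp: cs'(3)[simplified])
  have [measurable]: "Bad1 \<in> sets borel" unfolding Bad1_def left_translate_def by measurable
  \<comment> \<open>The translate by \<open>s'\<close> evaluated on \<open>A\<close> and
    \<open>B\<close> is \<open>f\<close> evaluated on \<open>A'\<close> and \<open>B'\<close>, so
    the ratio 2 becomes a property of \<open>f\<close> alone.\<close>
  define A' where "A' = (\<lambda>t. - s' + t) ` A"
  define B' where "B' = (\<lambda>t. - s' + t) ` B"
  define F' where "F' = F \<union> (\<lambda>(x, y). x + y) ` (C \<times> (A' \<union> B'))"
  have F': "compact F'" unfolding F'_def A'_def B'_def
    by (intro compact_Un compact_sums C F compact_translate_image A B)
  note [measurable] = compact_borel[OF F']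
  have ind: "(\<lambda>t. 2 * indicator F t) \<in> L" "\<And>c. (\<lambda>t. c * indicator (F' - F) t) \<in> L"
    by (auto intro: indicator_in_Lp[OF F] indicator_in_Lp[OF F'])
  define b where "b = nrm (\<lambda>t. indicator (F' - F) t)"
  \<comment> \<open>The perturbation costs less than \<open>e/2\<close>; the other half is left for
    approximating the perturbed target. The \<open>+ 1\<close> guards against
    \<open>b = 0\<close>.\<close>
  define \<eta> where "\<eta> = e / (2 * (b + 1))"
  have b: "b \<ge> 0" by (simp add: b_def Lp_norm_nonneg)
  then have \<eta>: "\<eta> > 0" using e by (simp add: \<eta>_def add_nonneg_pos)
  have "\<eta> * b < e / 2" using e b by (simp add: \<eta>_def field_simps)
  then have nrm\<eta>: "nrm (\<lambda>t. complex_of_real \<eta> * indicator (F' - F) t) < e / 2"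
    using \<eta> by (subst Lp_norm_cmult) (simp add: b_def)
  \<comment> \<open>Tolerance a quarter of \<open>\<eta>\<close> confines the moduli to the range
    from 3/4 to 5/4 of \<open>\<eta>\<close>, a ratio of at most 5/3, which contradicts the ratio
    2.\<close>
  obtain d2 where d2: "d2 > 0"
    "\<And>h. h \<in> L \<Longrightarrow> nrm h < d2 \<Longrightarrow> emeasure \<mu> {t\<in>F'. norm (h t) > \<eta>/4} < ennreal (1/2)"
    using norm_small_imp_small_in_measure[OF F', of "\<eta>/4" "1/2"] \<eta> by auto
  define v where "v t = 2 * indicator F t + complex_of_real \<eta> * indicator (F' - F) t" for t
  have v: "v \<in> L" unfolding v_def by (intro Lp_funs_add ind)
  obtain c s where cs: "c \<in> \<Gamma>" "s \<in> S" "nrm (\<lambda>t. c * left_translate s f t - v t) < min (e/2) d2"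
    using dense_vectorD(2)[OF dv v, of "min (e/2) d2"] e d2 by auto
  have hL: "(\<lambda>t. c * left_translate s f t - v t) \<in> L" by (intro Lp_funs_diff translate_in_Lp f cs v)
  define Bad2 where "Bad2 = {t\<in>F'. norm (c * left_translate s f t - v t) > \<eta>/4}"
  have Bad2: "emeasure \<mu> Bad2 < ennreal (1/2)" unfolding Bad2_def using cs(3) by (intro d2 hL) auto
  note [measurable] = Lp_borel[OF v]
  have [measurable]: "Bad2 \<in> sets borel" unfolding Bad2_def left_translate_def by measurable
  have "nrm (\<lambda>t. (c * left_translate s f t - v t) + complex_of_real \<eta> * indicator (F' - F) t)
      \<le> nrm (\<lambda>t. c * left_translate s f t - v t) + nrm (\<lambda>t. complex_of_real \<eta> * indicator (F' - F) t)"
    by (intro Lp_norm_triangle hL ind)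
  also have "\<dots> < e" using cs(3) nrm\<eta> by simp
  finally have "nrm (\<lambda>t. c * left_translate s f t - 2 * indicator F t) < e" by (simp add: v_def)
  moreover have "s \<notin> C"
  proof
    assume s: "s \<in> C"
    \<comment> \<open>By left invariance, \<open>D\<close> and the pulled-back exceptional sets
      together have measure at most \<open>m + 1\<close>, too little to cover a translate of
      \<open>X\<close>.\<close>
    have point: "\<exists>t\<in>(\<lambda>t. - s' + t) ` X. t \<notin> D \<and> s' + t \<notin> Bad1 \<and> s + t \<notin> Bad2"
      if X: "compact X" "emeasure \<mu> X > ennreal (m + 1)" for X
    proof (rule ccontr)
      assume "\<not> ?thesis"
      then have *: "(\<lambda>t. - s' + t) ` X \<subseteq> D \<union> ((\<lambda>t. - s' + t) ` Bad1 \<union> (\<lambda>t. - s + t) ` Bad2)"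
        by (auto simp: translate_image)
      note [measurable] = compact_borel[OF D] compact_borel[OF X(1)]
      have "emeasure \<mu> X = emeasure \<mu> ((\<lambda>t. - s' + t) ` X)" by (simp add: \<mu>_translate)
      also have "\<dots> \<le> emeasure \<mu> (D \<union> ((\<lambda>t. - s' + t) ` Bad1 \<union> (\<lambda>t. - s + t) ` Bad2))"
        by (rule emeasure_mono[OF *]) measurable
      also have "\<dots> \<le> emeasure \<mu> D + emeasure \<mu> ((\<lambda>t. - s' + t) ` Bad1 \<union> (\<lambda>t. - s + t) ` Bad2)"
        by (rule emeasure_subadditive) measurable
      also have "\<dots> \<le> emeasure \<mu> D + (emeasure \<mu> ((\<lambda>t. - s' + t) ` Bad1) + emeasure \<mu> ((\<lambda>t. - s + t) ` Bad2))"
        by (intro add_left_mono emeasure_subadditive) measurable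
      also have "\<dots> = emeasure \<mu> D + (emeasure \<mu> Bad1 + emeasure \<mu> Bad2)" by (simp add: \<mu>_translate)
      also have "\<dots> \<le> ennreal m + (ennreal (1/2) + ennreal (1/2))"
        using Bad1 Bad2 by (intro add_mono) (auto simp: m(1))
      also have "\<dots> = ennreal m + ennreal (1/2 + 1/2)" by (subst ennreal_plus) auto
      also have "\<dots> = ennreal (m + 1)" using m(2) by simp
      finally show False using X(2) by simp
    qed
    obtain a where a: "a \<in> A'" "a \<notin> D" "s' + a \<notin> Bad1" "s + a \<notin> Bad2"
      using point[OF A] unfolding A'_def by blast
    \<comment> \<open>From here on \<open>b\<close> is a group element and shadows the norm of the
      same name.\<close>
    obtain b where b: "b \<in> B'" "b \<notin> D" "s' + b \<notin> Bad1" "s + b \<notin> Bad2"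
      using point[OF B(1,2)] unfolding B'_def by blast
    have "s' + a \<in> A" "s' + b \<in> B" using a b by (auto simp: A'_def B'_def)
    moreover from this have "s' + b \<notin> A" using B(3) by blast
    ultimately have 1: "norm (c' * f a - 1) \<le> 1/3" "norm (c' * f b) \<le> 1/3"
      using a(3) b(3) B(3) by (auto simp: Bad1_def left_translate_def indicator_def not_less)
    have F'I: "s + x \<in> F' - F" if "x \<in> A' \<union> B'" "x \<notin> D" for x
    proof -
      have "s + x \<notin> F"
      proof
        assume "s + x \<in> F"
        then have "- s + (s + x) \<in> D" using s unfolding D_def by force
        then show False using that by simp
      qed
      then show ?thesis using that s unfolding F'_def by force
    qed
    have 2: "norm (c * f a - \<eta>) \<le> \<eta>/4" "norm (c * f b - \<eta>) \<le> \<eta>/4"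
      using F'I[of a] F'I[of b] a b by (auto simp: Bad2_def left_translate_def v_def not_less)
    have "norm (c' * f a) \<ge> 2/3"
      using 1(1) norm_triangle_sub[of 1 "c' * f a"] by (simp add: norm_minus_commute)
    then have "norm c' * (2 * norm (f b)) \<le> norm c' * norm (f a)" "norm c' > 0"
      using 1(2) by (auto simp: norm_mult)
    then have ab: "2 * norm (f b) \<le> norm (f a)" by (simp add: mult_le_cancel_left)
    have "norm (c * f a) \<le> 5/4 * \<eta>"
      using 2(1) \<eta> norm_triangle_sub[of "c * f a" "complex_of_real \<eta>"] by simp
    moreover have "norm (c * f b) \<ge> 3/4 * \<eta>"
      using 2(2) \<eta> norm_triangle_sub[of "complex_of_real \<eta>" "c * f b"] by (simp add: norm_minus_commute)
    moreover have "2 * norm (c * f b) \<le> norm (c * f a)"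
      using mult_left_mono[OF ab, of "norm c"] by (simp add: norm_mult algebra_simps)
    ultimately show False using \<eta> by linarith
  qed
  ultimately show ?thesis using cs by blast
qed

text \<open>Where \<open>l * f (- s + t)\<close> has modulus below 1, its distance to 2 exceeds 1,
  so that set is small. Outer regularity encloses it in a small open set, whose removal from
  \<open>F\<close> leaves the compact set \<open>K\<close>.\<close>

lemma dense_vector_step:
  assumes dv: "dense_vector \<mu> p \<omega> \<Gamma> S f" and C: "compact C" and F: "compact F" "emeasure \<mu> F > 0"
    and pos: "\<delta> > 0" "e > 0"
  shows "\<exists>s l K. s \<in> S \<and> s \<notin> C \<and> l \<in> \<Gamma> - {0} \<and> compact K \<and> K \<subseteq> F \<and> emeasure \<mu> (F - K) < ennreal \<delta>
    \<and> (\<forall>t\<in>K. 1 \<le> norm (l * f (- s + t))) \<and> nrm (\<lambda>t. l * left_translate s f t - 2 * indicator F t) < e"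
proof -
  note f = dense_vectorD(1)[OF dv]
  note [measurable] = Lp_borel[OF f] compact_borel[OF F(1)]
  \<comment> \<open>The cap by the measure of \<open>F\<close> forces \<open>l\<close> to be
    nonzero: for \<open>l = 0\<close> the error would be 2 on all of \<open>F\<close>.\<close>
  define \<delta>' where "\<delta>' = min \<delta> (enn2real (emeasure \<mu> F))"
  have \<delta>': "\<delta>' > 0" "\<delta>' \<le> \<delta>" "ennreal \<delta>' \<le> emeasure \<mu> F"
    using pos F \<mu>_compact[OF F(1)]
    by (cases "emeasure \<mu> F"; force simp: \<delta>'_def ennreal_leI)+
  obtain d where d: "d > 0"
    "\<And>h. h \<in> L \<Longrightarrow> nrm h < d \<Longrightarrow> emeasure \<mu> {t\<in>F. norm (h t) > 1} < ennreal \<delta>'"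
    using norm_small_imp_small_in_measure[OF F(1), of 1 \<delta>'] \<delta>' by auto
  obtain l s where ls: "l \<in> \<Gamma>" "s \<in> S" "s \<notin> C"
    "nrm (\<lambda>t. l * left_translate s f t - 2 * indicator F t) < min d e"
    using dense_vector_escapes_compact[OF dv C F(1), of "min d e"] d pos by auto
  let ?h = "\<lambda>t. l * left_translate s f t - 2 * indicator F t"
  have "?h \<in> L" by (intro Lp_funs_diff translate_in_Lp f ls indicator_in_Lp[OF F(1)]) auto
  then have bad: "emeasure \<mu> {t\<in>F. norm (?h t) > 1} < ennreal \<delta>'" using ls by (intro d) auto
  have "l \<noteq> 0"
  proof
    assume "l = 0"
    then have "{t\<in>F. norm (?h t) > 1} = F" by auto
    then show False using bad \<delta>'(3) by simp
  qed
  define A where "A = {t\<in>F. norm (l * f (- s + t)) < 1}"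
  have [measurable]: "A \<in> sets borel" unfolding A_def by measurable
  have "A \<subseteq> {t\<in>F. norm (?h t) > 1}"
  proof
    fix t assume t: "t \<in> A"
    then have "norm (l * f (- s + t)) < 1" by (simp add: A_def)
    then have "norm (l * f (- s + t) - 2) > 1"
      using norm_triangle_sub[of 2 "l * f (- s + t)"] by (simp add: norm_minus_commute)
    then show "t \<in> {t\<in>F. norm (?h t) > 1}" using t by (auto simp: A_def left_translate_def)
  qed
  then have "emeasure \<mu> A \<le> emeasure \<mu> {t\<in>F. norm (?h t) > 1}"
    by (rule emeasure_mono) (unfold left_translate_def, measurable)
  also note bad
  finally have "(INF U\<in>{U. open U \<and> A \<subseteq> U}. emeasure \<mu> U) < ennreal \<delta>'"
    using haarD(3)[of A] by simp
  then obtain U where U: "open U" "A \<subseteq> U" "emeasure \<mu> U < ennreal \<delta>'" by (auto simp: INF_less_iff)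
  have "emeasure \<mu> (F - (F - U)) \<le> emeasure \<mu> U" by (rule emeasure_mono) (use U in auto)
  also note U(3)
  also have "ennreal \<delta>' \<le> ennreal \<delta>" using \<delta>' by (simp add: ennreal_leI)
  finally have "emeasure \<mu> (F - (F - U)) < ennreal \<delta>" .
  moreover have "compact (F - U)" using F U by (simp add: compact_diff)
  moreover have "1 \<le> norm (l * f (- s + t))" if "t \<in> F - U" for t
    using that U(2) by (force simp: A_def)
  ultimately show ?thesis using ls \<open>l \<noteq> 0\<close> by (intro exI[of _ s] exI[of _ l] exI[of _ "F - U"]) auto
qed

section \<open>From a dense vector to the double series\<close>

text \<open>For compact \<open>A\<close> and \<open>B\<close> the forbidden values of
  \<open>r\<close> form a compact set, so disjointness from earlier translates becomes the kind of
  constraint that \<open>dense_vector_step\<close> can meet.\<close>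

lemma translates_disjoint_iff:
  fixes r s :: 'a
  shows "(\<lambda>t. - r + t) ` A \<inter> (\<lambda>t. - s + t) ` B = {} \<longleftrightarrow> r \<notin> (\<lambda>t. t + s) ` (\<lambda>(x, y). x - y) ` (A \<times> B)"
proof -
  have *: "- r + x = - s + y \<longleftrightarrow> r = x - y + s" for x y
  proof
    assume "- r + x = - s + y"
    then have "r + (- r + x) = r + (- s + y)" by (rule arg_cong)
    then have "x = r + (- s + y)" by (simp only: add_minus_cancel)
    then show "r = x - y + s" by (simp flip: add.assoc)
  next
    assume "r = x - y + s"
    then have "r + (- s + y) = x" by (simp flip: add.assoc)
    then have "- r + x = - r + (r + (- s + y))" by simp
    then show "- r + x = - s + y" by (simp only: minus_add_cancel)
  qed
  have "(\<lambda>t. - r + t) ` A \<inter> (\<lambda>t. - s + t) ` B = {} \<longleftrightarrow> (\<forall>x\<in>A. \<forall>y\<in>B. - r + x \<noteq> - s + y)"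
    by (simp add: disjoint_iff_not_equal)
  also have "\<dots> \<longleftrightarrow> r \<notin> (\<lambda>t. t + s) ` (\<lambda>(x, y). x - y) ` (A \<times> B)"
    unfolding * by (simp add: image_iff Ball_def)
  finally show ?thesis .
qed

lemma dense_vector_imp_summable:
  fixes F :: "nat \<Rightarrow> 'a set" and \<delta> :: "nat \<Rightarrow> real"
  assumes dv: "dense_vector \<mu> p \<omega> \<Gamma> S f"
    and F: "\<And>n. n \<ge> 1 \<Longrightarrow> compact (F n) \<and> emeasure \<mu> (F n) > 0"
    and \<delta>: "\<And>n. n \<ge> 1 \<Longrightarrow> \<delta> n > 0"
  shows "\<exists>(s :: nat \<Rightarrow> 'a) (l :: nat \<Rightarrow> complex) (K :: nat \<Rightarrow> 'a set).
          s 0 = 0 \<and> l 0 = 1 \<and> K 0 = {} \<and>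
          (\<forall>n\<ge>1. s n \<in> S \<and> l n \<in> \<Gamma> - {0} \<and> compact (K n) \<and> K n \<subseteq> F n) \<and>
          disjoint_family_on (\<lambda>n. (\<lambda>t. - s n + t) ` F n) {1..} \<and>
          (\<forall>n\<ge>1. emeasure \<mu> (F n - K n) < ennreal (\<delta> n)) \<and>
          (\<lambda>(n, k). norm (l n) powr p / norm (l k) powr p
              * norm_on \<mu> p ((\<lambda>t. s n - s k + t) ` K k) \<omega> powr p)
            summable_on {(n, k). n \<noteq> k}"
proof -
  note f = dense_vectorD(1)[OF dv]
  note [measurable] = Lp_borel[OF f]
  \<comment> \<open>\<open>h\<close> records the earlier choices and \<open>r\<close> is the triple
    proposed at stage \<open>n\<close>; stage 0 only fixes the conventional values.\<close>
  define P where "P h n r \<longleftrightarrow> (case r of (s, l, K) \<Rightarrow>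
      (n = 0 \<longrightarrow> s = 0 \<and> l = 1 \<and> K = {}) \<and>
      (n \<ge> 1 \<longrightarrow> s \<in> S \<and> l \<in> \<Gamma> - {0} \<and> compact K \<and> K \<subseteq> F n \<and> emeasure \<mu> (F n - K) < ennreal (\<delta> n)
        \<and> (\<forall>t\<in>K. 1 \<le> norm (l * f (- s + t)))
        \<and> nrm (\<lambda>t. l * left_translate s f t - 2 * indicator (F n) t) < (1/2)^n
        \<and> (\<forall>k<n. k \<ge> 1 \<longrightarrow> (\<lambda>t. - s + t) ` F n \<inter> (\<lambda>t. - fst (h k) + t) ` F k = {})))"
    for h :: "nat \<Rightarrow> 'a \<times> complex \<times> 'a set" and n r
  have "\<exists>h. \<forall>n. P h n (h n)"
  proof (rule dependent_wellorder_choice)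
    show "P h n r = P h' n r" if "\<And>y. y < n \<Longrightarrow> h y = h' y" for r h h' n
      using that by (simp add: P_def cong: conj_cong imp_cong)
    fix n and h :: "nat \<Rightarrow> 'a \<times> complex \<times> 'a set"
    show "\<exists>r. P h n r"
    proof (cases "n = 0")
      case True then show ?thesis by (intro exI[of _ "(0, 1, {})"]) (simp add: P_def)
    next
      case False
      define C where "C = (\<Union>k\<in>{1..<n}. (\<lambda>t. t + fst (h k)) ` (\<lambda>(x, y). x - y) ` (F n \<times> F k))"
      have "compact C" unfolding C_def using F False
        by (intro compact_UN finite_atLeastLessThan compact_continuous_image[OF _ compact_quotients] continuous_intros) auto
      from dense_vector_step[OF dv this, of "F n" "\<delta> n" "(1/2)^n"] False F \<delta>
      obtain s l K where *: "s \<in> S" "s \<notin> C" "l \<in> \<Gamma> - {0}" "compact K" "K \<subseteq> F n" "emeasure \<mu> (F n - K) < ennreal (\<delta> n)"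
        "\<forall>t\<in>K. 1 \<le> norm (l * f (- s + t))" "nrm (\<lambda>t. l * left_translate s f t - 2 * indicator (F n) t) < (1/2)^n"
        by auto
      have "(\<lambda>t. - s + t) ` F n \<inter> (\<lambda>t. - fst (h k) + t) ` F k = {}" if "k < n" "k \<ge> 1" for k
        using *(2) that unfolding translates_disjoint_iff C_def by auto
      with * False have "P h n (s, l, K)" by (simp add: P_def)
      then show ?thesis by blast
    qed
  qed
  then obtain h where h: "\<And>n. P h n (h n)" by blast
  define s l K where "s n = fst (h n)" and "l n = fst (snd (h n))" and "K n = snd (snd (h n))" for n
  have h0: "s 0 = 0" "l 0 = 1" "K 0 = {}"
    using h[of 0] by (auto simp: P_def s_def l_def K_def split: prod.splits)
  have h1: "s n \<in> S" "l n \<in> \<Gamma> - {0}" "compact (K n)" "K n \<subseteq> F n" "emeasure \<mu> (F n - K n) < ennreal (\<delta> n)"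
    "\<forall>t\<in>K n. 1 \<le> norm (l n * f (- s n + t))"
    "nrm (\<lambda>t. l n * left_translate (s n) f t - 2 * indicator (F n) t) < (1/2)^n"
    "\<forall>k<n. k \<ge> 1 \<longrightarrow> (\<lambda>t. - s n + t) ` F n \<inter> (\<lambda>t. - s k + t) ` F k = {}" if "n \<ge> 1" for n
    using h[of n] that by (auto simp: P_def s_def l_def K_def split: prod.splits)
  have disj: "(\<lambda>t. - s n + t) ` F n \<inter> (\<lambda>t. - s k + t) ` F k = {}" if "n \<ge> 1" "k \<ge> 1" "n \<noteq> k" for n k
    using that h1(8)[of n] h1(8)[of k] by (cases "n < k") (auto simp: Int_commute)
  have l0: "l n \<noteq> 0" for n using h0 h1(2)[of n] by (cases "n = 0") auto
  have K: "compact (K n)" for n using h0 h1(3)[of n] by (cases "n = 0") auto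
  define a where "a n k = norm (l n) powr p / norm (l k) powr p
              * norm_on \<mu> p ((\<lambda>t. s n - s k + t) ` K k) \<omega> powr p" for n k
  have a0: "a n k \<ge> 0" for n k by (simp add: a_def)
  define r where "r n = (if n = 0 then nrm f powr p else (1/2)^n)" for n :: nat
  have row: "(\<Sum>k\<in>I. a n k) \<le> r n" if I: "finite I" "n \<notin> I" for n I
  proof -
    \<comment> \<open>The error of the \<open>n\<close>-th approximation, which off
      \<open>F n\<close> agrees with the translated vector. At \<open>n = 0\<close> nothing is
      subtracted and \<open>g\<close> is \<open>f\<close>, whence the exceptional bound
      \<open>r 0\<close>.\<close>
    define g where "g t = l n * left_translate (s n) f t - (if n = 0 then 0 else 2 * indicator (F n) t)" for t
    have g: "g \<in> L \<and> nrm g powr p \<le> r n"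
    proof (cases "n = 0")
      case True then have "g = f" by (auto simp: g_def h0 left_translate_def)
      then show ?thesis using f True by (simp add: r_def)
    next
      case False
      then have n: "n \<ge> 1" by simp
      have eq: "g = (\<lambda>t. l n * left_translate (s n) f t - 2 * indicator (F n) t)" using False by (auto simp: g_def)
      have L: "g \<in> L" unfolding eq using F[OF n]
        by (intro Lp_funs_diff translate_in_Lp f h1[OF n] indicator_in_Lp[of "F n"]) (auto simp: compact_borel)
      have "nrm g powr p \<le> ((1/2)^n) powr p"
        using h1(7)[OF n] p Lp_norm_nonneg[of g] unfolding eq by (intro powr_mono2) auto
      also have "\<dots> \<le> ((1/2)^n) powr 1" using p by (intro powr_mono') (auto simp: power_le_one)
      finally show ?thesis using L False by (simp add: r_def)
    qed
    note [measurable] = Lp_borel[OF conjunct1[OF g]]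
    \<comment> \<open>For fixed \<open>n\<close> these are the translates by \<open>s n\<close> of
      pairwise disjoint sets, so the row is the integral of a step function lying below
      \<open>norm (g t) powr p\<close>.\<close>
    let ?A = "\<lambda>k. (\<lambda>t. s n - s k + t) ` K k"
    have [measurable]: "?A k \<in> sets borel" for k by (intro compact_borel compact_translate_image K)
    have a_eq: "ennreal (a n k) = ennreal (norm (l n) powr p / norm (l k) powr p) * emeasure \<nu> (?A k)" for k
      unfolding a_def \<nu>_compact(3)[OF compact_translate_image[OF K]] by (rule ennreal_mult') simp
    have "ennreal (\<Sum>k\<in>I. a n k) = (\<Sum>k\<in>I. ennreal (norm (l n) powr p / norm (l k) powr p) * emeasure \<nu> (?A k))"
      unfolding a_eq[symmetric] by (rule sum_ennreal[symmetric]) (rule a0)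
    also have "\<dots> = (\<integral>\<^sup>+t. (\<Sum>k\<in>I. ennreal (norm (l n) powr p / norm (l k) powr p) * indicator (?A k) t) \<partial>\<nu>)"
      by (simp add: nn_integral_sum nn_integral_cmult)
    also have "\<dots> \<le> (\<integral>\<^sup>+t. ennreal (norm (g t) powr p) \<partial>\<nu>)"
    proof (intro nn_integral_mono sum_indicator_le_of_disjoint)
      fix t k assume k: "k \<in> I" "t \<in> ?A k"
      then have kn: "k \<noteq> n" "k \<ge> 1" using I h0 by (auto simp: Suc_le_eq intro: ccontr)
      obtain x where x: "x \<in> K k" "t = s n - s k + x" using k by blast
      \<comment> \<open>Pulled back by \<open>s n\<close>, the point lies over \<open>K k\<close>,
        where \<open>f\<close> has modulus at least \<open>1 / norm (l k)\<close>; disjointness then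
        keeps \<open>t\<close> out of \<open>F n\<close>.\<close>
      have tx: "- s n + t = - s k + x"
        unfolding x by (simp add: add_diff_eq flip: add.assoc)
      have "g t = l n * f (- s k + x)"
      proof (cases "n = 0")
        case False
        have "t \<notin> F n"
        proof
          assume "t \<in> F n"
          then have "- s k + x \<in> (\<lambda>t. - s n + t) ` F n" by (metis image_eqI tx)
          moreover have "- s k + x \<in> (\<lambda>t. - s k + t) ` F k" using x h1(4)[OF kn(2)] by blast
          ultimately show False using disj[of n k] kn False by auto
        qed
        then show ?thesis by (simp add: g_def left_translate_def tx)
      qed (simp add: g_def left_translate_def flip: tx)
      moreover have "1 \<le> norm (l k) * norm (f (- s k + x))" using h1(6)[OF kn(2)] x by (auto simp: norm_mult)
      then have "1 / norm (l k) \<le> norm (f (- s k + x))" using l0[of k] by (simp add: field_simps)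
      then have "norm (l n) / norm (l k) \<le> norm (l n) * norm (f (- s k + x))"
        using mult_left_mono[of _ _ "norm (l n)"] by fastforce
      ultimately have "(norm (l n) / norm (l k)) powr p \<le> norm (g t) powr p"
        using p by (intro powr_mono2) (auto simp: norm_mult)
      then show "ennreal (norm (l n) powr p / norm (l k) powr p) \<le> ennreal (norm (g t) powr p)"
        by (simp add: powr_divide ennreal_leI)
    next
      fix t k j assume kj: "k \<in> I" "j \<in> I" "t \<in> ?A k" "t \<in> ?A j"
      then have "k \<ge> 1" "j \<ge> 1" using h0 by (auto simp: Suc_le_eq intro: ccontr)
      moreover have "- s n + t \<in> (\<lambda>t. - s i + t) ` F i" if "t \<in> ?A i" "i \<ge> 1" for i
      proof -
        from that(1) obtain x where x: "x \<in> K i" "t = s n - s i + x" by blast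
        have "- s n + t = - s i + x"
          unfolding x by (simp add: add_diff_eq flip: add.assoc)
        then show ?thesis using x h1(4)[OF that(2)] by auto
      qed
      ultimately show "k = j" using disj[of k j] kj(3,4) by (metis disjoint_iff)
    qed (rule I(1))
    also have "\<dots> = ennreal (nrm g powr p)" by (rule nn_Lp_norm) (use g in blast)
    also have "\<dots> \<le> ennreal (r n)" using g by (intro ennreal_leI) blast
    finally show ?thesis by (subst (asm) ennreal_le_iff) (auto simp: r_def)
  qed
  have "(\<lambda>(n, k). a n k) summable_on {(n, k). n \<noteq> k}"
  proof (rule nonneg_bdd_above_summable_on)
    show "0 \<le> (case x of (n, k) \<Rightarrow> a n k)" for x using a0 by (auto split: prod.split)
    show "bdd_above (sum (\<lambda>(n, k). a n k) ` {X. X \<subseteq> {(n, k). n \<noteq> k} \<and> finite X})"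
    proof (rule bdd_aboveI2)
      fix X :: "(nat \<times> nat) set" assume "X \<in> {X. X \<subseteq> {(n, k). n \<noteq> k} \<and> finite X}"
      then have X: "X \<subseteq> {(n, k). n \<noteq> k}" "finite X" by auto
      obtain N where N: "fst ` X \<union> snd ` X \<subseteq> {..<N}" using finite_nat_iff_bounded[of "fst ` X \<union> snd ` X"] X by auto
      \<comment> \<open>Enlarging \<open>X\<close> to a square without its diagonal allows summation
        by rows; the final constant 2 is the geometric series of the row bounds.\<close>
      have "(\<Sum>(n, k)\<in>X. a n k) \<le> (\<Sum>(n, k)\<in>Sigma {..<N} (\<lambda>n. {..<N} - {n}). a n k)"
        using X N a0 by (intro sum_mono2) force+
      also have "\<dots> = (\<Sum>n<N. \<Sum>k\<in>{..<N} - {n}. a n k)" by (rule sum.Sigma[symmetric]) auto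
      also have "\<dots> \<le> (\<Sum>n<N. r n)" by (intro sum_mono row) auto
      also have "\<dots> \<le> (\<Sum>n<N. (if n = 0 then nrm f powr p else 0) + (1/2)^n)"
        by (intro sum_mono) (simp add: r_def)
      also have "\<dots> \<le> nrm f powr p + 2"
        using sum_le_suminf[of "\<lambda>n. (1/2)^n :: real" "{..<N}"]
        by (simp add: sum.distrib suminf_geometric summable_geometric)
      finally show "(\<Sum>(n, k)\<in>X. a n k) \<le> nrm f powr p + 2" .
    qed
  qed
  then show ?thesis using h0 h1 disj unfolding a_def disjoint_family_on_def
    by (intro exI[of _ s] exI[of _ l] exI[of _ K]) auto
qed

section \<open>Separability\<close>

text \<open>The Lindelof property makes the cover by relatively compact open sets countable; finite
  unions of enclosing compact sets then increase to the group.\<close>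

lemma compact_exhaustion: "\<exists>E :: nat \<Rightarrow> 'a set. (\<forall>n. compact (E n)) \<and> incseq E \<and> (\<Union>n. E n) = UNIV"
proof -
  let ?U = "{U :: 'a set. open U \<and> (\<exists>K. compact K \<and> U \<subseteq> K)}"
  have "\<exists>U\<in>?U. x \<in> U" for x :: 'a
  proof -
    obtain U K where "open U" "compact K" "x \<in> U" "U \<subseteq> K"
      using locally_compact unfolding locally_compact_space_def
      by (metis UNIV_I compactin_euclidean_iff open_openin topspace_euclidean)
    then show ?thesis by blast
  qed
  then have cover: "\<Union>?U = UNIV" by blast
  obtain V where V: "V \<subseteq> ?U" "countable V" "\<Union>V = \<Union>?U"
    using Lindelof[of ?U] by blast
  have "V \<noteq> {}" using V(3) cover by auto
  obtain c where c: "\<And>U. U \<in> V \<Longrightarrow> compact (c U) \<and> U \<subseteq> c U" using V(1) 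
  proof -
    have "\<forall>U\<in>V. \<exists>K. compact K \<and> U \<subseteq> K" using V(1) by blast
    then show ?thesis using that by metis
  qed
  let ?v = "from_nat_into V"
  have v: "?v i \<in> V" for i using \<open>V \<noteq> {}\<close> by (rule from_nat_into)
  define E where "E n = (\<Union>i\<le>n. c (?v i))" for n
  have "x \<in> (\<Union>n. E n)" for x
  proof -
    have "x \<in> \<Union>V" by (simp only: V(3) cover UNIV_I)
    then obtain U where U: "U \<in> V" "x \<in> U" by (rule UnionE)
    then obtain i where "?v i = U" using from_nat_into_surj[OF V(2) U(1)] by blast
    then have "x \<in> c (?v i)" using c[OF U(1)] U(2) by blast
    then show ?thesis unfolding E_def by blast
  qed
  moreover have "compact (E n)" for n unfolding E_def using c v by (intro compact_UN) auto
  moreover have "incseq E" unfolding E_def by (rule incseq_SucI) (auto simp: atMost_Suc)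
  ultimately show ?thesis by (intro exI[of _ E]) blast
qed

lemma Lp_funs_bound:
  assumes "g \<in> L" "f \<in> borel_measurable borel" "\<And>t. norm (f t) \<le> norm (g t)"
  shows "f \<in> L"
proof -
  have "(\<integral>\<^sup>+t. ennreal (norm (f t) powr p) \<partial>\<nu>) \<le> (\<integral>\<^sup>+t. ennreal (norm (g t) powr p) \<partial>\<nu>)"
    using p assms(3) by (intro nn_integral_mono ennreal_leI powr_mono2) auto
  also have "\<dots> < \<infinity>" using assms(1) Lp_borel[OF assms(1)] by (simp add: Lp_iff_nn)
  finally show ?thesis using assms(2) by (simp add: Lp_iff_nn)
qed

lemma Lp_dominated_convergence:
  assumes g: "g \<in> L" and [measurable]: "\<And>n. u n \<in> borel_measurable borel"
    and le: "\<And>n t. norm (u n t) \<le> norm (g t)" and lim: "\<And>t. (\<lambda>n. u n t) \<longlonglongrightarrow> 0" and e: "e > 0"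
  shows "eventually (\<lambda>n. nrm (u n) < e) sequentially"
proof -
  note [measurable] = Lp_borel[OF g]
  have "(\<lambda>n. LINT t|\<mu>. norm (u n t) powr p * \<omega> t powr p) \<longlonglongrightarrow> (LINT t|\<mu>. 0)"
  proof (rule integral_dominated_convergence)
    show "integrable \<mu> (\<lambda>t. norm (g t) powr p * \<omega> t powr p)" using g by (simp add: Lp_funs_def)
    show "AE t in \<mu>. (\<lambda>n. norm (u n t) powr p * \<omega> t powr p) \<longlonglongrightarrow> 0"
    proof (rule AE_I2)
      fix t
      have "(\<lambda>n. norm (u n t) powr p) \<longlonglongrightarrow> 0 powr p"
        using p by (intro tendsto_powr2 tendsto_norm_zero lim tendsto_const) auto
      then show "(\<lambda>n. norm (u n t) powr p * \<omega> t powr p) \<longlonglongrightarrow> 0" by (intro tendsto_mult_left_zero) simp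
    qed
    show "AE t in \<mu>. norm (norm (u n t) powr p * \<omega> t powr p) \<le> norm (g t) powr p * \<omega> t powr p" for n
      using p le by (intro AE_I2) (auto intro!: mult_right_mono powr_mono2)
  qed auto
  then have "(\<lambda>n. nrm (u n) powr p) \<longlonglongrightarrow> 0" by (simp add: Lp_norm_powr)
  then have "eventually (\<lambda>n. nrm (u n) powr p < e powr p) sequentially"
    using e by (intro order_tendstoD(2)) auto
  then show ?thesis using Lp_norm_less_iff[OF e] by simp
qed

lemma bounded_compact_support_in_Lp:
  assumes [measurable]: "f \<in> borel_measurable borel" and K: "compact K"
    and f: "\<And>t. norm (f t) \<le> B" "\<And>t. t \<notin> K \<Longrightarrow> f t = 0"
  shows "f \<in> L"
proof (rule Lp_funs_bound[OF indicator_in_Lp[OF K]])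
  have "0 \<le> B" using f(1) norm_ge_zero order_trans by blast
  then show "norm (f t) \<le> norm (complex_of_real B * indicator K t)" for t using f[of t] by (cases "t \<in> K") auto
qed (use K in \<open>auto simp: compact_borel\<close>)

text \<open>Outer regularity of the Haar measure lets a countable basis of the topology approximate
  Borel sets of finite measure.\<close>

lemma indicator_approx:
  assumes E: "compact E" and A: "A \<in> sets borel" "A \<subseteq> E" and b: "topological_basis (range b)" and e: "e > 0"
  shows "\<exists>js :: nat list. nrm (\<lambda>t. indicator A t - indicator ((\<Union>i\<in>set js. b i) \<inter> E) t) < e"
proof -
  note [measurable] = A(1) compact_borel[OF E]
  have bo: "open (b i)" for i using topological_basis_open[OF b] by blast
  \<comment> \<open>Two error sets of measure below \<open>e'\<close> are added; a third instead of
    a half gives strictness.\<close>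
  define e' where "e' = e powr p / 3"
  have e': "e' > 0" using e by (simp add: e'_def)
  obtain d where d: "d > 0" "\<And>A. A \<in> sets borel \<Longrightarrow> A \<subseteq> E \<Longrightarrow> emeasure \<mu> A < ennreal d \<Longrightarrow> emeasure \<nu> A < ennreal e'"
    using \<nu>_small[OF E e'] by blast
  have "emeasure \<mu> A \<le> emeasure \<mu> E" by (rule emeasure_mono) (use A in auto)
  then have \<mu>A: "emeasure \<mu> A < \<infinity>" using \<mu>_compact[OF E] by (rule le_less_trans)
  then have "emeasure \<mu> A < emeasure \<mu> A + ennreal d" using d(1)
    by (cases "emeasure \<mu> A") (auto simp: ennreal_less_iff simp flip: ennreal_plus)
  then obtain V where V: "open V" "A \<subseteq> V" "emeasure \<mu> V < emeasure \<mu> A + ennreal d"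
    using haarD(3)[OF A(1)] by (auto simp: INF_less_iff)
  note [measurable] = borel_open[OF V(1)]
  have "emeasure \<mu> V = emeasure \<mu> A + emeasure \<mu> (V - A)"
    by (subst plus_emeasure) (use V in \<open>auto simp: Un_absorb1\<close>)
  then have "emeasure \<mu> (V - A) < ennreal d" using V(3) \<mu>A
    by (metis add_left_mono leD leI)
  moreover have "emeasure \<mu> (V \<inter> E - A) \<le> emeasure \<mu> (V - A)" by (rule emeasure_mono) auto
  ultimately have V1: "emeasure \<nu> (V \<inter> E - A) < ennreal e'" by (intro d(2)) auto
  \<comment> \<open>Only basic sets inside \<open>V\<close> are used, so nothing outside
    \<open>V\<close> is added, while these finite unions exhaust \<open>V\<close>.\<close>
  define U where "U j = (\<Union>i\<in>{i. i < j \<and> b i \<subseteq> V}. b i)" for j :: nat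
  have U: "open (U j)" "U j \<subseteq> V" for j using bo by (auto simp: U_def)
  note [measurable] = borel_open[OF U(1)]
  have "(\<lambda>j. emeasure \<nu> (V \<inter> E - U j)) \<longlonglongrightarrow> emeasure \<nu> (\<Inter>j. V \<inter> E - U j)"
  proof (rule Lim_emeasure_decseq)
    show "decseq (\<lambda>j. V \<inter> E - U j)" by (fastforce simp: decseq_def U_def)
    have "emeasure \<nu> (V \<inter> E - U j) \<le> emeasure \<nu> E" for j by (rule emeasure_mono) auto
    then show "emeasure \<nu> (V \<inter> E - U j) \<noteq> \<infinity>" for j
      using \<nu>_compact(1)[OF E] by (metis infinity_ennreal_def leD top.not_eq_extremum)
  qed auto
  moreover have "(\<Inter>j. V \<inter> E - U j) = {}"
  proof -
    have "\<exists>j. x \<in> U j" if x: "x \<in> V" for x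
    proof -
      obtain B' where "B' \<in> range b" "x \<in> B'" "B' \<subseteq> V" using topological_basisE[OF b V(1) x] by blast
      then obtain i where "x \<in> b i" "b i \<subseteq> V" by blast
      then have "x \<in> U (Suc i)" by (auto simp: U_def)
      then show ?thesis by blast
    qed
    then show ?thesis by blast
  qed
  ultimately have "(\<lambda>j. emeasure \<nu> (V \<inter> E - U j)) \<longlonglongrightarrow> 0" by (simp only: emeasure_empty)
  then have "eventually (\<lambda>j. emeasure \<nu> (V \<inter> E - U j) < ennreal e') sequentially"
    using e' by (intro order_tendstoD(2)) auto
  then obtain j where j: "emeasure \<nu> (V \<inter> E - U j) < ennreal e'" by (auto dest: eventually_happens)
  obtain js where "set js = {i. i < j \<and> b i \<subseteq> V}" using finite_list[of "{i. i < j \<and> b i \<subseteq> V}"] by auto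
  then have Ujs: "U j = (\<Union>i\<in>set js. b i)" by (simp add: U_def)
  let ?W = "(V \<inter> E - A) \<union> (V \<inter> E - U j)"
  have "nrm (\<lambda>t. indicator A t - indicator (U j \<inter> E) t) < e"
  proof (rule Lp_norm_lessI(2)[OF _ e])
    have "(\<integral>\<^sup>+t. ennreal (norm (indicator A t - indicator (U j \<inter> E) t :: complex) powr p) \<partial>\<nu>)
        \<le> (\<integral>\<^sup>+t. indicator ?W t \<partial>\<nu>)"
      using A V(2) subsetD[OF U(2)[of j]] p by (intro nn_integral_mono) (auto simp: indicator_def)
    also have "\<dots> = emeasure \<nu> ?W" by simp
    also have "\<dots> \<le> emeasure \<nu> (V \<inter> E - A) + emeasure \<nu> (V \<inter> E - U j)" by (rule emeasure_subadditive) auto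
    also have "\<dots> \<le> ennreal e' + ennreal e'" using V1 j by (intro add_mono) auto
    also have "\<dots> = ennreal (e' + e')" using e' by (intro ennreal_plus[symmetric]) auto
    also have "\<dots> < ennreal (e powr p)" using e by (intro ennreal_lessI) (auto simp: e'_def)
    finally show "(\<integral>\<^sup>+t. ennreal (norm (indicator A t - indicator (U j \<inter> E) t :: complex) powr p) \<partial>\<nu>) < ennreal (e powr p)" .
  qed measurable
  then show ?thesis unfolding Ujs by blast
qed

text \<open>Countability comes from coding: \<open>m\<close> is decoded as a list of triples giving
  a scalar from a countable dense set, finitely many basic open sets and a compact set of the
  exhaustion. Appending lists adds functions, so approximability (\<open>Ap\<close>) is closed under
  sums and limits and spreads from indicators to nonnegative and then to complex functions.\<close>

lemma countable_dense_bounded_support: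
  fixes E :: "nat \<Rightarrow> 'a set"
  assumes E: "\<And>n. compact (E n)" "incseq E" "(\<Union>n. E n) = UNIV"
  shows "\<exists>\<psi> :: nat \<Rightarrow> 'a \<Rightarrow> complex. (\<forall>m. \<psi> m \<in> borel_measurable borel)
    \<and> (\<forall>m. \<exists>B k. \<forall>t. norm (\<psi> m t) \<le> B \<and> (t \<notin> E k \<longrightarrow> \<psi> m t = 0))
    \<and> (\<forall>f\<in>L. \<forall>e>0. \<exists>m. nrm (\<lambda>t. f t - \<psi> m t) < e)"
proof -
  note [measurable] = compact_borel[OF E(1)]
  obtain \<B> :: "'a set set" where \<B>: "countable \<B>" "topological_basis \<B>" using ex_countable_basis by blast
  have "\<B> \<noteq> {}" using topological_basisE[OF \<B>(2) open_UNIV UNIV_I, of undefined] by auto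
  define b where "b = from_nat_into \<B>"
  have b: "topological_basis (range b)" using \<B> \<open>\<B> \<noteq> {}\<close> by (simp add: b_def range_from_nat_into)
  have [measurable]: "b i \<in> sets borel" for i by (intro borel_open topological_basis_open[OF b]) simp
  obtain D :: "complex set" where D: "countable D" "\<And>X. open X \<Longrightarrow> X \<noteq> {} \<Longrightarrow> \<exists>d\<in>D. d \<in> X"
    by (rule countable_dense_setE) blast
  have "D \<noteq> {}" using D(2)[of UNIV] by auto
  define U where "U js k = (\<Union>i\<in>set js. b i) \<inter> E k" for js k
  define h where "h = (\<lambda>(q :: nat, js, k) t. from_nat_into D q * indicator (U js k) t :: complex)"
  define \<psi> where "\<psi> m t = (\<Sum>x\<leftarrow>from_nat m. h x t)" for m t
  have U [measurable]: "U js k \<in> sets borel" for js k unfolding U_def by measurable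
  have [measurable]: "h x \<in> borel_measurable borel" for x by (cases x) (simp add: h_def)
  have \<psi>_meas [measurable]: "\<psi> m \<in> borel_measurable borel" for m
  proof -
    have "(\<lambda>t. \<Sum>x\<leftarrow>xs. h x t) \<in> borel_measurable borel" for xs by (induction xs) auto
    then show ?thesis unfolding \<psi>_def by simp
  qed
  have \<psi>_bd: "\<exists>B k. \<forall>t. norm (\<psi> m t) \<le> B \<and> (t \<notin> E k \<longrightarrow> \<psi> m t = 0)" for m
    unfolding \<psi>_def
  proof (rule sum_list_bounded_support[OF E(2)])
    show "\<exists>B k. \<forall>t. norm (h x t) \<le> B \<and> (t \<notin> E k \<longrightarrow> h x t = 0)" for x
      by (cases x) (auto simp: h_def U_def indicator_def intro!: exI[of _ "norm (from_nat_into D (fst x))"] exI[of _ "snd (snd x)"])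
  qed
  then have \<psi>L: "\<psi> m \<in> L" for m
    using bounded_compact_support_in_Lp[OF \<psi>_meas E(1)] by metis
  define Ap where "Ap f \<longleftrightarrow> f \<in> L \<and> (\<forall>e>0. \<exists>m. nrm (\<lambda>t. f t - \<psi> m t) < e)" for f
  have Ap_add: "Ap (\<lambda>t. f t + g t)" if f: "Ap f" and g: "Ap g" for f g
    unfolding Ap_def
  proof (intro conjI allI impI)
    show "(\<lambda>t. f t + g t) \<in> L" using f g by (auto simp: Ap_def Lp_funs_add)
    fix e :: real assume "e > 0"
    then obtain m n where mn: "nrm (\<lambda>t. f t - \<psi> m t) < e/2" "nrm (\<lambda>t. g t - \<psi> n t) < e/2"
      using f g unfolding Ap_def by (meson half_gt_zero)
    define k where "k = to_nat (from_nat m @ from_nat n :: (nat \<times> nat list \<times> nat) list)"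
    have "\<psi> k t = \<psi> m t + \<psi> n t" for t by (simp add: \<psi>_def k_def)
    then have "(\<lambda>t. f t + g t - \<psi> k t) = (\<lambda>t. (f t - \<psi> m t) + (g t - \<psi> n t))" by (auto simp: fun_eq_iff)
    then have "nrm (\<lambda>t. f t + g t - \<psi> k t) \<le> nrm (\<lambda>t. f t - \<psi> m t) + nrm (\<lambda>t. g t - \<psi> n t)"
      using f g by (auto simp: Ap_def intro!: Lp_norm_triangle Lp_funs_diff \<psi>L)
    then show "\<exists>m. nrm (\<lambda>t. f t + g t - \<psi> m t) < e" using mn by (intro exI[of _ k]) simp
  qed
  have Ap_lim: "Ap f" if f: "f \<in> L" and lim: "\<And>e. e > 0 \<Longrightarrow> \<exists>g. Ap g \<and> nrm (\<lambda>t. f t - g t) < e" for f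
    unfolding Ap_def
  proof (intro conjI allI impI f)
    fix e :: real assume "e > 0"
    then obtain g where g: "Ap g" "nrm (\<lambda>t. f t - g t) < e/2" using lim[of "e/2"] by auto
    obtain m where m: "nrm (\<lambda>t. g t - \<psi> m t) < e/2" using g(1) \<open>e > 0\<close> unfolding Ap_def by (meson half_gt_zero)
    have "nrm (\<lambda>t. (f t - g t) + (g t - \<psi> m t)) \<le> nrm (\<lambda>t. f t - g t) + nrm (\<lambda>t. g t - \<psi> m t)"
      using f g by (intro Lp_norm_triangle Lp_funs_diff \<psi>L) (auto simp: Ap_def)
    then show "\<exists>m. nrm (\<lambda>t. f t - \<psi> m t) < e" using g m by (intro exI[of _ m]) simp
  qed
  have Ap_ind: "Ap (\<lambda>t. c * indicator A t)" if A: "A \<in> sets borel" "A \<subseteq> E k" for c A k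
    unfolding Ap_def
  proof (intro conjI allI impI)
    have L: "(\<lambda>t. a * indicator X t) \<in> L" if "X \<in> sets borel" "X \<subseteq> E k" for a X
      using that by (intro indicator_in_Lp[OF E(1)])
    show "(\<lambda>t. c * indicator A t) \<in> L" using A by (rule L)
    fix e :: real assume e: "e > 0"
    have "e / (2 * (norm c + 1)) > 0" using e by (simp add: add_nonneg_pos)
    from indicator_approx[OF E(1) A b this] obtain js where
      "nrm (\<lambda>t. indicator A t - indicator (U js k) t) < e / (2 * (norm c + 1))" unfolding U_def by blast
    then have "(norm c + 1) * nrm (\<lambda>t. indicator A t - indicator (U js k) t) < e / 2"
      by (subst (asm) pos_less_divide_eq) (auto simp: algebra_simps add_pos_nonneg)
    moreover have "norm c * nrm (\<lambda>t. indicator A t - indicator (U js k) t)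
        \<le> (norm c + 1) * nrm (\<lambda>t. indicator A t - indicator (U js k) t)"
      by (intro mult_right_mono Lp_norm_nonneg) auto
    ultimately have 1: "norm c * nrm (\<lambda>t. indicator A t - indicator (U js k) t) < e / 2" by linarith
    define y where "y = nrm (indicator (U js k))"
    have y: "y \<ge> 0" by (simp add: y_def Lp_norm_nonneg)
    have "e / (2 * (y + 1)) > 0" using e y by (intro divide_pos_pos) auto
    then have "ball c (e / (2 * (y + 1))) \<noteq> {}" by (metis ball_eq_empty not_less)
    then obtain d where d: "d \<in> D" "dist c d < e / (2 * (y + 1))" using D(2)[OF open_ball] by fastforce
    then have "norm (c - d) * (y + 1) < e / 2"
      using y by (subst (asm) pos_less_divide_eq) (auto simp: dist_norm algebra_simps)
    moreover have "norm (c - d) * y \<le> norm (c - d) * (y + 1)" by (intro mult_left_mono) auto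
    ultimately have 2: "norm (c - d) * y < e / 2" by linarith
    obtain q where q: "from_nat_into D q = d" using d D(1) from_nat_into_surj by metis
    define m where "m = to_nat [(q, js, k)]"
    have \<psi>m: "\<psi> m t = d * indicator (U js k) t" for t by (simp add: \<psi>_def m_def h_def q)
    have Uk: "U js k \<subseteq> E k" by (simp add: U_def)
    have "nrm (\<lambda>t. c * indicator A t - \<psi> m t)
        = nrm (\<lambda>t. c * (indicator A t - indicator (U js k) t) + (c - d) * indicator (U js k) t)"
      by (rule arg_cong[of _ _ nrm]) (auto simp: \<psi>m algebra_simps)
    also have "\<dots> \<le> nrm (\<lambda>t. c * (indicator A t - indicator (U js k) t)) + nrm (\<lambda>t. (c - d) * indicator (U js k) t)"
      using L[OF A, of 1] L[OF U Uk, of 1] by (intro Lp_norm_triangle Lp_funs_cmult Lp_funs_diff) auto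
    also have "\<dots> < e" using 1 2 by (simp add: Lp_norm_cmult y_def)
    finally show "\<exists>m. nrm (\<lambda>t. c * indicator A t - \<psi> m t) < e" by blast
  qed
  \<comment> \<open>The scalar is quantified inside the induction so that the multiplication case
    can absorb its real factor into \<open>c\<close>.\<close>
  have Ap_nonneg: "\<forall>c. Ap (\<lambda>t. c * complex_of_real (u t))"
    if u: "u \<in> borel_measurable borel" "\<And>t. 0 \<le> u t" "(\<lambda>t. complex_of_real (u t)) \<in> L" for u
    using u
  proof (induction rule: borel_measurable_induct_real)
    case (set A)
    show ?case
    proof (intro allI Ap_lim)
      fix c
      show L: "(\<lambda>t. c * complex_of_real (indicator A t)) \<in> L" using set(2) by (rule Lp_funs_cmult)
      fix e :: real assume e: "e > 0"
      note [measurable] = set(1)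
      \<comment> \<open>\<open>A\<close> need not lie in a compact set, so it is first cut down
        along the exhaustion.\<close>
      have "eventually (\<lambda>n. nrm (\<lambda>t. c * complex_of_real (indicator A t) - c * indicator (A \<inter> E n) t) < e) sequentially"
      proof (rule Lp_dominated_convergence[OF L _ _ _ e])
        fix t
        obtain n0 where n0: "t \<in> E n0" using E(3) by blast
        have "eventually (\<lambda>n. c * complex_of_real (indicator A t) - c * indicator (A \<inter> E n) t = 0) sequentially"
          using eventually_ge_at_top[of n0]
        proof eventually_elim
          case (elim n)
          then have "t \<in> E n" using n0 E(2) by (auto simp: incseq_def)
          then show ?case by (simp add: indicator_def)
        qed
        then show "(\<lambda>n. c * complex_of_real (indicator A t) - c * indicator (A \<inter> E n) t) \<longlonglongrightarrow> 0"
          by (rule tendsto_eventually)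
      qed (auto simp: indicator_def)
      then obtain n where "nrm (\<lambda>t. c * complex_of_real (indicator A t) - c * indicator (A \<inter> E n) t) < e"
        by (auto dest: eventually_happens)
      moreover have "Ap (\<lambda>t. c * indicator (A \<inter> E n) t)" by (rule Ap_ind[of _ n]) auto
      ultimately show "\<exists>g. Ap g \<and> nrm (\<lambda>t. c * complex_of_real (indicator A t) - g t) < e" by blast
    qed
  next
    case (mult u k)
    show ?case
    proof (cases "k = 0")
      case True
      then show ?thesis using Ap_ind[of "{}" 0] by simp
    next
      case False
      have "(\<lambda>t. complex_of_real (1/k) * complex_of_real (k * u t)) \<in> L" using mult.prems by (rule Lp_funs_cmult)
      then have "(\<lambda>t. complex_of_real (u t)) \<in> L" using False by simp
      then have *: "\<forall>c. Ap (\<lambda>t. c * complex_of_real (u t))" by (rule mult.IH)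
      show ?thesis using *[rule_format, of "_ * complex_of_real k"] by (simp add: mult.assoc)
    qed
  next
    case (add u v)
    have "(\<lambda>t. complex_of_real (u t)) \<in> L" "(\<lambda>t. complex_of_real (v t)) \<in> L"
      using add.hyps by (auto intro!: Lp_funs_bound[OF add.prems] simp flip: of_real_add simp del: of_real_add)
    then have *: "\<forall>c. Ap (\<lambda>t. c * complex_of_real (u t))" "\<forall>c. Ap (\<lambda>t. c * complex_of_real (v t))"
      using add.IH by blast+
    show ?case using Ap_add[OF *(2)[rule_format] *(1)[rule_format]] by (simp add: distrib_left)
  next
    case (seq U)
    have u: "u \<in> borel_measurable borel"
      by (rule borel_measurable_LIMSEQ_real[OF seq.hyps(4) seq.hyps(1)]) simp
    have lim: "(\<lambda>n. U n t) \<longlonglongrightarrow> u t" for t using seq.hyps(4)[of t] by simp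
    have Uu: "U i t \<le> u t" for i t
      by (rule incseq_le[OF _ lim]) (use seq.hyps(3) in \<open>auto simp: incseq_def le_fun_def\<close>)
    have U0: "0 \<le> U i t" for i t by (rule seq.hyps(2))
    have u0: "0 \<le> u t" for t by (rule order_trans[OF U0 Uu])
    have UL: "(\<lambda>t. complex_of_real (U i t)) \<in> L" for i
      using seq.hyps(1)[of i] Uu[of i] U0[of i] u0 by (intro Lp_funs_bound[OF seq.prems]) auto
    show ?case
    proof (intro allI Ap_lim)
      fix c
      show L: "(\<lambda>t. c * complex_of_real (u t)) \<in> L" using seq.prems by (rule Lp_funs_cmult)
      fix e :: real assume e: "e > 0"
      have "eventually (\<lambda>n. nrm (\<lambda>t. c * complex_of_real (u t) - c * complex_of_real (U n t)) < e) sequentially"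
      proof (rule Lp_dominated_convergence[OF L _ _ _ e])
        note [measurable] = u seq.hyps(1)
        show "(\<lambda>t. c * complex_of_real (u t) - c * complex_of_real (U n t)) \<in> borel_measurable borel" for n by measurable
        fix t
        show "norm (c * complex_of_real (u t) - c * complex_of_real (U n t)) \<le> norm (c * complex_of_real (u t))" for n
          using Uu[of n t] U0[of n t] u0[of t]
          by (simp add: norm_mult mult_left_mono flip: right_diff_distrib of_real_diff)
        have "(\<lambda>n. c * complex_of_real (u t) - c * complex_of_real (U n t)) \<longlonglongrightarrow> c * complex_of_real (u t) - c * complex_of_real (u t)"
          by (intro tendsto_intros lim)
        then show "(\<lambda>n. c * complex_of_real (u t) - c * complex_of_real (U n t)) \<longlonglongrightarrow> 0" by simp
      qed
      then obtain n where "nrm (\<lambda>t. c * complex_of_real (u t) - c * complex_of_real (U n t)) < e"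
        by (auto dest: eventually_happens)
      moreover have "Ap (\<lambda>t. c * complex_of_real (U n t))" using seq.IH[OF UL] by blast
      ultimately show "\<exists>g. Ap g \<and> nrm (\<lambda>t. c * complex_of_real (u t) - g t) < e" by blast
    qed
  qed
  have "Ap f" if f: "f \<in> L" for f
  proof -
    note [measurable] = Lp_borel[OF f]
    have A: "Ap (\<lambda>t. c * complex_of_real (u t))"
      if "u \<in> borel_measurable borel" "\<And>t. 0 \<le> u t" "\<And>t. u t \<le> norm (f t)" for u c
    proof -
      have "(\<lambda>t. complex_of_real (u t)) \<in> L" by (rule Lp_funs_bound[OF f]) (use that in auto)
      from Ap_nonneg[OF that(1,2) this] show ?thesis by (rule spec)
    qed
    have bounds: "max 0 (Re (f t)) \<le> norm (f t)" "max 0 (- Re (f t)) \<le> norm (f t)"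
      "max 0 (Im (f t)) \<le> norm (f t)" "max 0 (- Im (f t)) \<le> norm (f t)" for t
      using abs_Re_le_cmod[of "f t"] abs_Im_le_cmod[of "f t"] by (simp_all add: abs_le_iff)
    have Re: "Ap (\<lambda>t. 1 * complex_of_real (max 0 (Re (f t))))" "Ap (\<lambda>t. (-1) * complex_of_real (max 0 (- Re (f t))))"
      by (rule A, simp, simp, rule bounds)+
    have Im: "Ap (\<lambda>t. \<i> * complex_of_real (max 0 (Im (f t))))" "Ap (\<lambda>t. (-\<i>) * complex_of_real (max 0 (- Im (f t))))"
      by (rule A, simp, simp, rule bounds)+
    have "Ap (\<lambda>t. (1 * complex_of_real (max 0 (Re (f t))) + (-1) * complex_of_real (max 0 (- Re (f t))))
      + (\<i> * complex_of_real (max 0 (Im (f t))) + (-\<i>) * complex_of_real (max 0 (- Im (f t)))))"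
      by (rule Ap_add[OF Ap_add[OF Re] Ap_add[OF Im]])
    also have "(\<lambda>t. (1 * complex_of_real (max 0 (Re (f t))) + (-1) * complex_of_real (max 0 (- Re (f t))))
      + (\<i> * complex_of_real (max 0 (Im (f t))) + (-\<i>) * complex_of_real (max 0 (- Im (f t))))) = f"
      by (rule ext) (auto simp: complex_eq_iff max_def)
    finally show ?thesis .
  qed
  then show ?thesis using \<psi>_meas \<psi>_bd unfolding Ap_def by (intro exI[of _ \<psi>]) blast
qed

section \<open>Vectors with a dense orbit\<close>

lemma topspace_Lp [simp]: "topspace (Lp_topology \<mu> p \<omega>) = Lp_space \<mu> p \<omega>"
  unfolding Lp_topology_def by (rule Metric_space.topspace_mtopology[OF Metric_space_Lp])

text \<open>Open sets of the product contain boxes around their points, and for finitely many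
  coordinates one radius fits all sides.\<close>

lemma dense_tupleI:
  assumes f: "\<And>i. i \<in> {1..N} \<Longrightarrow> f i \<in> L"
    and approx: "\<And>g e. (\<And>i. i \<in> {1..N} \<Longrightarrow> g i \<in> L) \<Longrightarrow> e > 0 \<Longrightarrow>
      \<exists>c\<in>\<Gamma>. \<exists>s\<in>S. \<forall>i\<in>{1..N}. nrm (\<lambda>t. c * left_translate s (f i) t - g i t) < e"
  shows "dense_tuple \<mu> p \<omega> \<Gamma> S N f"
proof -
  interpret M: Metric_space "Lp_space \<mu> p \<omega>" "Lp_dist \<mu> p \<omega>" by (rule Metric_space_Lp)
  let ?X = "product_topology (\<lambda>i. Lp_topology \<mu> p \<omega>) {1..N}"
  let ?o = "\<lambda>c s. \<lambda>i\<in>{1..N}. Lp_class \<mu> p \<omega> (\<lambda>t. c * left_translate s (f i) t)"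
  let ?O = "{?o c s | c s. c \<in> \<Gamma> \<and> s \<in> S}"
  have orbit: "Lp_class \<mu> p \<omega> (\<lambda>t. c * left_translate s (f i) t) \<in> Lp_space \<mu> p \<omega>"
    if "s \<in> S" "i \<in> {1..N}" for c s i
    using translate_in_Lp(2)[OF f[OF that(2)] that(1)] by (auto simp: Lp_space_def)
  then have sub: "?O \<subseteq> topspace ?X" by auto
  have *: "x \<in> ?X closure_of ?O" if x: "x \<in> topspace ?X" for x
    unfolding in_closure_of
  proof (intro conjI allI impI x, elim conjE)
    fix U assume U: "x \<in> U" "openin ?X U"
    then obtain V where V: "\<And>i. i \<in> {1..N} \<Longrightarrow> openin (Lp_topology \<mu> p \<omega>) (V i)"
      "x \<in> Pi\<^sub>E {1..N} V" "Pi\<^sub>E {1..N} V \<subseteq> U"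
      unfolding openin_product_topology_alt by metis
    have "\<exists>g. g \<in> L \<and> x i = Lp_class \<mu> p \<omega> g" if "i \<in> {1..N}" for i
    proof -
      have "x i \<in> Lp_space \<mu> p \<omega>"
        using x that unfolding topspace_product_topology topspace_Lp by (rule PiE_mem)
      then show ?thesis by (auto simp: Lp_space_def)
    qed
    then obtain g where g: "\<And>i. i \<in> {1..N} \<Longrightarrow> g i \<in> L \<and> x i = Lp_class \<mu> p \<omega> (g i)" by metis
    have "\<exists>e>0. M.mball (x i) e \<subseteq> V i" if "i \<in> {1..N}" for i
    proof -
      have "x i \<in> V i" using V(2) that by (rule PiE_mem)
      then show ?thesis using V(1)[OF that] unfolding Lp_topology_def M.openin_mtopology by blast
    qed
    then obtain e where e: "\<And>i. i \<in> {1..N} \<Longrightarrow> e i > 0 \<and> M.mball (x i) (e i) \<subseteq> V i" by metis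
    \<comment> \<open>The inserted 1 keeps the minimum meaningful for \<open>N = 0\<close>.\<close>
    define d where "d = Min (insert 1 (e ` {1..N}))"
    have d: "d > 0" unfolding d_def using e by (subst Min_gr_iff) auto
    have de: "d \<le> e i" if "i \<in> {1..N}" for i unfolding d_def by (rule Min_le) (use that in auto)
    obtain c s where cs: "c \<in> \<Gamma>" "s \<in> S"
      "\<And>i. i \<in> {1..N} \<Longrightarrow> nrm (\<lambda>t. c * left_translate s (f i) t - g i t) < d"
      using approx[of g d] g d by blast
    have "?o c s i \<in> V i" if i: "i \<in> {1..N}" for i
    proof -
      have L: "(\<lambda>t. c * left_translate s (f i) t) \<in> L" by (rule translate_in_Lp(2)[OF f[OF i] cs(2)])
      have "Lp_dist \<mu> p \<omega> (Lp_class \<mu> p \<omega> (\<lambda>t. c * left_translate s (f i) t)) (x i) < d"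
        unfolding conjunct2[OF g[OF i]] Lp_dist_class[OF L conjunct1[OF g[OF i]]] by (rule cs(3)[OF i])
      then have "Lp_dist \<mu> p \<omega> (x i) (Lp_class \<mu> p \<omega> (\<lambda>t. c * left_translate s (f i) t)) < e i"
        by (rule ord_eq_less_trans[OF M.commute less_le_trans[OF _ de[OF i]]])
      moreover have "x i \<in> Lp_space \<mu> p \<omega>" unfolding Lp_space_def using g[OF i] by blast
      ultimately have "Lp_class \<mu> p \<omega> (\<lambda>t. c * left_translate s (f i) t) \<in> M.mball (x i) (e i)"
        using orbit[OF cs(2) i] by (simp add: M.in_mball)
      with e[OF i] have "Lp_class \<mu> p \<omega> (\<lambda>t. c * left_translate s (f i) t) \<in> V i" by blast
      then show ?thesis using i by simp
    qed
    then have "?o c s \<in> Pi\<^sub>E {1..N} V" by (intro PiE_I) auto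
    then have "?o c s \<in> U" using V(3) by blast
    then show "\<exists>y. y \<in> ?O \<and> y \<in> U" using cs by blast
  qed
  have "?X closure_of ?O = topspace ?X"
    by (rule subset_antisym[OF closure_of_subset_topspace subsetI]) (rule *)
  with sub show ?thesis unfolding dense_tuple_def dense_in_space_def using f by (intro conjI ballI)
qed

text \<open>The first projection is continuous, so it maps the closure of the orbit of the tuple
  into the closure of the orbit of \<open>f 1\<close>; constant tuples reach every point.\<close>

lemma dense_tuple_imp_dense_vector:
  assumes "dense_tuple \<mu> p \<omega> \<Gamma> S N f" "N \<ge> 1"
  shows "dense_vector \<mu> p \<omega> \<Gamma> S (f 1)"
proof -
  let ?X = "product_topology (\<lambda>i. Lp_topology \<mu> p \<omega>) {1..N}"
  let ?o = "\<lambda>c s. \<lambda>i\<in>{1..N}. Lp_class \<mu> p \<omega> (\<lambda>t. c * left_translate s (f i) t)"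
  let ?O = "{?o c s | c s. c \<in> \<Gamma> \<and> s \<in> S}"
  let ?P = "{Lp_class \<mu> p \<omega> (\<lambda>t. c * left_translate s (f 1) t) | c s. c \<in> \<Gamma> \<and> s \<in> S}"
  have 1: "1 \<in> {1..N}" using assms(2) by simp
  have f: "f 1 \<in> L" using assms(1)[unfolded dense_tuple_def] 1 by (elim conjE) (rule bspec)
  have proj: "(\<lambda>x. x 1) ` ?O \<subseteq> ?P"
  proof (rule image_subsetI, elim CollectE exE conjE)
    fix x c s assume *: "x = ?o c s" "c \<in> \<Gamma>" "s \<in> S"
    then have "x 1 = Lp_class \<mu> p \<omega> (\<lambda>t. c * left_translate s (f 1) t)" using 1 by simp
    with *(2,3) show "x 1 \<in> ?P" by (intro CollectI exI conjI)
  qed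
  have dense: "?X closure_of ?O = topspace ?X"
    using assms(1)[unfolded dense_tuple_def dense_in_space_def] by (elim conjE)
  have "?P \<subseteq> Lp_space \<mu> p \<omega>"
    using translate_in_Lp(2)[OF f] by (auto simp: Lp_space_def)
  moreover have "x \<in> Lp_topology \<mu> p \<omega> closure_of ?P" if x: "x \<in> Lp_space \<mu> p \<omega>" for x
  proof -
    have "(\<lambda>i\<in>{1..N}. x) \<in> ?X closure_of ?O" unfolding dense using x by simp
    then have "(\<lambda>i\<in>{1..N}. x) 1 \<in> (\<lambda>x. x 1) ` (?X closure_of ?O)" by (rule imageI)
    also have "\<dots> \<subseteq> Lp_topology \<mu> p \<omega> closure_of ((\<lambda>x. x 1) ` ?O)"
      by (intro continuous_map_image_closure_subset continuous_map_product_projection 1)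
    also have "\<dots> \<subseteq> Lp_topology \<mu> p \<omega> closure_of ?P" by (rule closure_of_mono[OF proj])
    finally show ?thesis using 1 by simp
  qed
  ultimately show ?thesis using f closure_of_subset_topspace[of "Lp_topology \<mu> p \<omega>" ?P]
    unfolding dense_vector_def dense_in_space_def topspace_Lp by blast
qed

section \<open>From the double series to dense tuples\<close>

lemma summable_imp_dense_tuple:
  fixes N :: nat
  assumes cond: "\<And>(F :: nat \<Rightarrow> 'a set) (\<delta> :: nat \<Rightarrow> real).
        (\<forall>n\<ge>1. compact (F n) \<and> emeasure \<mu> (F n) > 0 \<and> F n \<subseteq> F (Suc n)) \<and>
        (\<forall>n\<ge>1. \<delta> n > 0) \<Longrightarrow>
        (\<exists>(s :: nat \<Rightarrow> 'a) (l :: nat \<Rightarrow> complex) (K :: nat \<Rightarrow> 'a set).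
          s 0 = 0 \<and> l 0 = 1 \<and> K 0 = {} \<and>
          (\<forall>n\<ge>1. s n \<in> S \<and> l n \<in> \<Gamma> - {0} \<and> compact (K n) \<and> K n \<subseteq> F n) \<and>
          disjoint_family_on (\<lambda>n. (\<lambda>t. - s n + t) ` F n) {1..} \<and>
          (\<forall>n\<ge>1. emeasure \<mu> (F n - K n) < ennreal (\<delta> n)) \<and>
          (\<lambda>(n, k). norm (l n) powr p / norm (l k) powr p
              * norm_on \<mu> p ((\<lambda>t. s n - s k + t) ` K k) \<omega> powr p)
            summable_on {(n, k). n \<noteq> k})"
  shows "\<exists>f. dense_tuple \<mu> p \<omega> \<Gamma> S N f"
proof -
  obtain E :: "nat \<Rightarrow> 'a set" where E: "\<And>n. compact (E n)" "incseq E" "(\<Union>n. E n) = UNIV"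
    using compact_exhaustion by blast
  obtain K0 :: "'a set" where K0: "compact K0" "emeasure \<mu> K0 > 0" using positive_compact by blast
  obtain \<psi> :: "nat \<Rightarrow> 'a \<Rightarrow> complex" where \<psi>: "\<And>m. \<psi> m \<in> borel_measurable borel"
    "\<And>m. \<exists>B k. \<forall>t. norm (\<psi> m t) \<le> B \<and> (t \<notin> E k \<longrightarrow> \<psi> m t = 0)"
    "\<And>f e. f \<in> L \<Longrightarrow> e > 0 \<Longrightarrow> \<exists>m. nrm (\<lambda>t. f t - \<psi> m t) < e"
    using countable_dense_bounded_support[OF E] by blast
  obtain B0 k0 where B0: "\<And>m t. norm (\<psi> m t) \<le> B0 m" "\<And>m t. t \<notin> E (k0 m) \<Longrightarrow> \<psi> m t = 0"
    using \<psi>(2) by metis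
  \<comment> \<open>\<open>K0\<close> provides positive measure; monotonicity lets a function
    supported in some \<open>E k\<close> fit into all later \<open>F n\<close>.\<close>
  define F where "F n = E n \<union> K0" for n
  have F: "compact (F n)" for n using E K0 by (auto simp: F_def)
  have F_mono: "m \<le> n \<Longrightarrow> F m \<subseteq> F n" for m n using E(2) by (auto simp: F_def incseq_def)
  have F_pos: "emeasure \<mu> (F n) > 0" for n
    by (rule less_le_trans[OF K0(2) emeasure_mono]) (use F in \<open>auto simp: F_def compact_borel\<close>)
  have "\<exists>d>0. \<forall>A\<in>sets borel. A \<subseteq> F n \<longrightarrow> emeasure \<mu> A < ennreal d \<longrightarrow> emeasure \<nu> A < ennreal ((1/2)^n)" for n
    by (intro \<nu>_small F) simp
  then obtain \<delta> where \<delta>: "\<And>n. \<delta> n > 0" "\<And>n A. A \<in> sets borel \<Longrightarrow> A \<subseteq> F n \<Longrightarrow> emeasure \<mu> A < ennreal (\<delta> n)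
      \<Longrightarrow> emeasure \<nu> A < ennreal ((1/2)^n)" by metis
  obtain s l K where h0: "s 0 = 0" "l 0 = (1::complex)" "K 0 = {}"
    and h1: "\<And>n. n \<ge> 1 \<Longrightarrow> s n \<in> S \<and> l n \<in> \<Gamma> - {0} \<and> compact (K n) \<and> K n \<subseteq> F n"
    and dis: "disjoint_family_on (\<lambda>n. (\<lambda>t. - s n + t) ` F n) {1..}"
    and FK: "\<And>n. n \<ge> 1 \<Longrightarrow> emeasure \<mu> (F n - K n) < ennreal (\<delta> n)"
    and summ: "(\<lambda>(n, k). norm (l n) powr p / norm (l k) powr p
              * norm_on \<mu> p ((\<lambda>t. s n - s k + t) ` K k) \<omega> powr p) summable_on {(n, k). n \<noteq> k}"
  proof -
    have pre: "(\<forall>n\<ge>1. compact (F n) \<and> emeasure \<mu> (F n) > 0 \<and> F n \<subseteq> F (Suc n)) \<and> (\<forall>n\<ge>1. \<delta> n > 0)"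
      using F F_pos F_mono[OF le_SucI[OF order_refl]] \<delta>(1) by simp
    show thesis using cond[OF pre] by (elim exE conjE) (rule that; simp)
  qed
  have l0: "l n \<noteq> 0" for n using h0 h1[of n] by (cases "n = 0") auto
  have K: "compact (K n)" for n using h0 h1[of n] by (cases "n = 0") auto
  define T where "T n k = (\<lambda>t. s n - s k + t) ` K k" for n k
  have T: "compact (T n k)" for n k unfolding T_def by (intro compact_translate_image K)
  note [measurable] = compact_borel[OF T] compact_borel[OF K] compact_borel[OF F] \<psi>(1)
  \<comment> \<open>A zero diagonal turns sums over off-diagonal pairs into iterated sums over all
    indices.\<close>
  define a' where "a' n k = (if n = k then 0 else norm (l n) powr p / norm (l k) powr p
              * norm_on \<mu> p (T n k) \<omega> powr p)" for n k
  have a'0: "a' n k \<ge> 0" for n k by (simp add: a'_def)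
  define a where "a n k = ennreal (a' n k)" for n k
  have a: "a n k = (if n = k then 0 else ennreal (norm (l n) powr p / norm (l k) powr p) * emeasure \<nu> (T n k))" for n k
    unfolding \<nu>_compact(3)[OF T] a_def a'_def by (simp flip: ennreal_mult')
  have total: "(\<Sum>k. \<Sum>n. a n k) < \<infinity>"
  proof -
    let ?g = "\<lambda>(n, k). norm (l n) powr p / norm (l k) powr p * norm_on \<mu> p ((\<lambda>t. s n - s k + t) ` K k) \<omega> powr p"
    define R where "R = infsum ?g {(n, k). n \<noteq> k}"
    have fin: "(\<Sum>n<m'. \<Sum>k<m. a n k) \<le> ennreal R" for m m'
    proof -
      have "(\<Sum>n<m'. \<Sum>k<m. a' n k) = (\<Sum>(n, k)\<in>{..<m'} \<times> {..<m}. a' n k)" by (rule sum.cartesian_product)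
      also have "\<dots> = sum ?g ({..<m'} \<times> {..<m} \<inter> {(n, k). n \<noteq> k})"
        by (rule sum.mono_neutral_cong_right) (auto simp: a'_def T_def)
      also have "\<dots> \<le> R" unfolding R_def by (rule finite_sum_le_infsum[OF summ]) auto
      finally have "ennreal (\<Sum>n<m'. \<Sum>k<m. a' n k) \<le> ennreal R" by (rule ennreal_leI)
      then show ?thesis using a'0 by (simp add: a_def sum_nonneg)
    qed
    have "(\<Sum>k. \<Sum>n. a n k) \<le> ennreal R"
    proof (rule suminf_le_const[OF summableI])
      fix m
      have "(\<Sum>k<m. \<Sum>n. a n k) = (\<Sum>n. \<Sum>k<m. a n k)" by (rule suminf_sum[symmetric]) (rule summableI)
      also have "\<dots> \<le> ennreal R" by (rule suminf_le_const[OF summableI fin])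
      finally show "(\<Sum>k<m. \<Sum>n. a n k) \<le> ennreal R" .
    qed
    also have "\<dots> < \<infinity>" by simp
    finally show ?thesis .
  qed
  define \<alpha> where "\<alpha> k = (\<Sum>n. a n k)" for k
  have \<alpha>: "\<alpha> \<longlonglongrightarrow> 0" using total unfolding \<alpha>_def by (rule ennreal_suminf_tendsto_zero)
  text \<open>Every finite list of indices is the first component of infinitely many \<open>from_nat j\<close>, so the
    tuples \<open>(\<phi> j i)\<^sub>i\<close> visit each tuple of the \<open>\<psi> m\<close> infinitely often.\<close>
  define pick where "pick j i = fst (from_nat j :: nat list \<times> nat) ! i" for j i
  define \<phi> where "\<phi> j i = \<psi> (pick j i)" for j i
  \<comment> \<open>A sum in place of a maximum: it bounds all coordinates at once, as does
    \<open>kk\<close> for the support indices.\<close>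
  define B where "B j = (\<Sum>i=1..N. B0 (pick j i))" for j
  define kk where "kk j = (\<Sum>i=1..N. k0 (pick j i))" for j
  have B0_nonneg: "0 \<le> B0 m" for m by (rule order_trans[OF norm_ge_zero B0(1)])
  have B: "norm (\<phi> j i t) \<le> B j" if "i \<in> {1..N}" for i j t
    unfolding \<phi>_def B_def by (rule order_trans[OF B0(1) member_le_sum[OF that]]) (auto simp: B0_nonneg)
  have B_nonneg: "0 \<le> B j" for j unfolding B_def by (intro sum_nonneg B0_nonneg)
  have \<phi>_supp: "\<phi> j i t = 0" if "i \<in> {1..N}" "n \<ge> kk j" "t \<notin> F n" for i j t n
  proof -
    have "k0 (pick j i) \<le> kk j" unfolding kk_def by (rule member_le_sum[OF that(1)]) auto
    then have "E (k0 (pick j i)) \<subseteq> F n" 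
      using incseqD[OF E(2), of "k0 (pick j i)" n] that(2) unfolding F_def by (intro le_supI1) simp
    then show ?thesis using that(3) unfolding \<phi>_def by (intro B0(2)) blast
  qed
  \<comment> \<open>The last two requirements make negligible, respectively, what the
    \<open>j\<close>-th summand contributes to all other rows and what is lost on
    \<open>F (r j) - K (r j)\<close>.\<close>
  have "\<exists>r. strict_mono r \<and> (\<forall>j. 1 \<le> r j \<and> kk j \<le> r j \<and> ennreal (B j powr p) * \<alpha> (r j) < ennreal ((1/2)^j)
      \<and> B j powr p * (1/2)^(r j) < (1/2)^j)"
  proof (rule strict_mono_choice, intro eventually_conj eventually_ge_at_top)
    fix j
    have "(\<lambda>n. ennreal (B j powr p) * \<alpha> n) \<longlonglongrightarrow> ennreal (B j powr p) * 0"
      by (intro ennreal_tendsto_cmult \<alpha>) simp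
    then show "eventually (\<lambda>n. ennreal (B j powr p) * \<alpha> n < ennreal ((1/2)^j)) sequentially"
      by (intro order_tendstoD(2)) auto
    have "(\<lambda>n. B j powr p * (1/2)^n) \<longlonglongrightarrow> B j powr p * 0"
      by (intro tendsto_mult tendsto_const LIMSEQ_power_zero) simp
    then show "eventually (\<lambda>n. B j powr p * (1/2)^n < (1/2)^j) sequentially"
      by (intro order_tendstoD(2)) auto
  qed
  then obtain r where r: "strict_mono r" "\<And>j. 1 \<le> r j" "\<And>j. kk j \<le> r j"
    "\<And>j. ennreal (B j powr p) * \<alpha> (r j) < ennreal ((1/2)^j)" "\<And>j. B j powr p * (1/2)^(r j) < (1/2)^j"
    by blast
  have r_inj: "r i = r j \<longleftrightarrow> i = j" for i j using r(1) by (simp add: strict_mono_eq)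
  \<comment> \<open>A bound for what the \<open>n\<close>-th operator makes of all summands other
    than its own, which drops out because \<open>a n n = 0\<close>.\<close>
  define Rs where "Rs n = (\<Sum>j. ennreal (B j powr p) * a n (r j))" for n
  have sum\<alpha>: "(\<Sum>j. ennreal (B j powr p) * \<alpha> (r j)) < \<infinity>"
  proof -
    have "(\<Sum>j. ennreal (B j powr p) * \<alpha> (r j)) \<le> (\<Sum>j. ennreal ((1/2)^j))"
      by (intro suminf_le summableI less_imp_le r)
    also have "\<dots> < \<infinity>" by (subst suminf_ennreal2) (auto simp: summable_geometric)
    finally show ?thesis .
  qed
  have a\<alpha>: "a n k \<le> \<alpha> k" for n k
    unfolding \<alpha>_def using sum_le_suminf[OF summableI, of "{n}" "\<lambda>n. a n k"] by simp
  have Rs0: "Rs 0 < \<infinity>"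
    by (rule le_less_trans[OF _ sum\<alpha>]) (unfold Rs_def, intro suminf_le summableI mult_left_mono a\<alpha>, simp)
  \<comment> \<open>Summed by columns, these bounds have a finite total, so they tend to zero along
    \<open>r\<close>.\<close>
  have "(\<Sum>i. Rs (r i)) = (\<Sum>j. \<Sum>i. ennreal (B j powr p) * a (r i) (r j))"
    unfolding Rs_def by (rule ennreal_suminf_swap)
  also have "\<dots> = (\<Sum>j. ennreal (B j powr p) * (\<Sum>i. a (r i) (r j)))" by (simp add: ennreal_suminf_cmult)
  also have "\<dots> \<le> (\<Sum>j. ennreal (B j powr p) * \<alpha> (r j))"
    unfolding \<alpha>_def by (intro suminf_le summableI mult_left_mono ennreal_suminf_subsequence_le r(1)) simp
  also note sum\<alpha>
  finally have Rs_lim: "(\<lambda>i. Rs (r i)) \<longlonglongrightarrow> 0" by (rule ennreal_suminf_tendsto_zero)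
  define f where "f i t = (\<Sum>j. indicator (K (r j)) (s (r j) + t) * (\<phi> j i (s (r j) + t) / l (r j)))" for i t
  have [measurable]: "\<phi> j i \<in> borel_measurable borel" for j i unfolding \<phi>_def by measurable
  have f_meas [measurable]: "f i \<in> borel_measurable borel" for i unfolding f_def by measurable
  have disj: "i = j" if "s (r i) + t \<in> K (r i)" "s (r j) + t \<in> K (r j)" for i j t
  proof (rule ccontr)
    assume "i \<noteq> j"
    then have "(\<lambda>t. - s (r i) + t) ` F (r i) \<inter> (\<lambda>t. - s (r j) + t) ` F (r j) = {}"
      using dis r(2) r_inj unfolding disjoint_family_on_def by auto
    moreover have "t \<in> (\<lambda>t. - s (r k) + t) ` F (r k)" if "s (r k) + t \<in> K (r k)" for k
      using that h1[OF r(2)[of k]] by (auto simp: translate_image)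
    ultimately show False using that by blast
  qed
  have f_val: "f i t = \<phi> j i (s (r j) + t) / l (r j)" if "s (r j) + t \<in> K (r j)" for i j t
  proof -
    have "f i t = (\<Sum>j\<in>{j}. indicator (K (r j)) (s (r j) + t) * (\<phi> j i (s (r j) + t) / l (r j)))"
      unfolding f_def using disj[OF that] by (intro suminf_finite) (auto simp: indicator_def)
    then show ?thesis using that by simp
  qed
  have f_zero: "f i t = 0" if "\<And>j. s (r j) + t \<notin> K (r j)" for i t
    using that by (simp add: f_def)
  have T_iff: "t \<in> T n k \<longleftrightarrow> s k + (- s n + t) \<in> K k" for n k t
    unfolding T_def translate_image by (simp add: minus_diff_eq add_diff_eq flip: add.assoc) 
  \<comment> \<open>Used twice: \<open>n = 0\<close> with \<open>D\<close> empty and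
    \<open>y\<close> zero gives membership in the space; \<open>n = r j\<close> with target
    \<open>\<phi> j i\<close> gives convergence.\<close>
  have estimate: "(\<integral>\<^sup>+t. ennreal (norm (l n * f i (- s n + t) - y t) powr p) \<partial>\<nu>)
      \<le> ennreal (b powr p) * emeasure \<nu> (D - K n) + Rs n"
    if i: "i \<in> {1..N}" and D: "compact D" and y: "\<And>t. norm (y t) \<le> b" "\<And>t. t \<notin> D \<Longrightarrow> y t = 0"
      and eq: "\<And>j. n = r j \<Longrightarrow> y = \<phi> j i" and ne: "\<And>j. n \<noteq> r j \<Longrightarrow> D \<inter> T n (r j) = {}"
      and Kn: "K n \<subseteq> (\<Union>j. T n (r j))"
    for n i D y b
  proof -
    note [measurable] = compact_borel[OF D]
    define c where "c j = (if n = r j then 0 else ennreal (B j powr p) * ennreal (norm (l n) powr p / norm (l (r j)) powr p))" for j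
    have "(\<integral>\<^sup>+t. ennreal (norm (l n * f i (- s n + t) - y t) powr p) \<partial>\<nu>)
      \<le> (\<integral>\<^sup>+t. ennreal (b powr p) * indicator (D - K n) t + (\<Sum>j. c j * indicator (T n (r j)) t) \<partial>\<nu>)"
    proof (rule nn_integral_mono)
      fix t
      \<comment> \<open>On \<open>T n n\<close>, which is \<open>K n\<close>, the target is met
        exactly; on the other pieces the target vanishes; elsewhere \<open>f\<close> vanishes and
        only the target on \<open>D - K n\<close> is left.\<close>
      consider j where "t \<in> T n (r j)" "n = r j" | j where "t \<in> T n (r j)" "n \<noteq> r j" | "\<And>j. t \<notin> T n (r j)" by blast
      then show "ennreal (norm (l n * f i (- s n + t) - y t) powr p)
          \<le> ennreal (b powr p) * indicator (D - K n) t + (\<Sum>j. c j * indicator (T n (r j)) t)"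
      proof cases
        case 1
        then have "l n * f i (- s n + t) = \<phi> j i (s (r j) + (- s n + t))"
          using f_val[of j "- s n + t" i] l0[of n] by (simp add: T_iff)
        then have "l n * f i (- s n + t) - y t = 0" using eq[OF 1(2)] 1(2) by simp
        then show ?thesis by simp
      next
        case 2
        then have "y t = 0" using ne[OF 2(2)] y(2) by blast
        have "f i (- s n + t) = \<phi> j i (s (r j) + (- s n + t)) / l (r j)"
          using f_val[of j "- s n + t" i] 2(1) by (simp add: T_iff)
        then have "norm (l n * f i (- s n + t) - y t) = norm (l n) / norm (l (r j)) * norm (\<phi> j i (s (r j) + (- s n + t)))"
          using \<open>y t = 0\<close> by (simp add: norm_mult norm_divide)
        also have "\<dots> \<le> norm (l n) / norm (l (r j)) * B j" by (intro mult_left_mono B i) auto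
        finally have "norm (l n * f i (- s n + t) - y t) powr p \<le> (norm (l n) / norm (l (r j)) * B j) powr p"
          using p by (intro powr_mono2) auto
        also have "\<dots> = norm (l n) powr p / norm (l (r j)) powr p * B j powr p"
          using B_nonneg by (simp add: powr_mult powr_divide)
        finally have "ennreal (norm (l n * f i (- s n + t) - y t) powr p) \<le> c j"
          using 2(2) by (simp add: c_def ennreal_leI mult.commute flip: ennreal_mult')
        also have "\<dots> \<le> (\<Sum>j. c j * indicator (T n (r j)) t)" using 2(1) by (rule suminf_indicator_ge)
        also have "\<dots> \<le> ennreal (b powr p) * indicator (D - K n) t + (\<Sum>j. c j * indicator (T n (r j)) t)" by simp
        finally show ?thesis .
      next
        case 3
        then have "f i (- s n + t) = 0" by (intro f_zero) (simp add: T_iff)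
        moreover have "t \<notin> K n" using 3 Kn by blast
        ultimately have "ennreal (norm (l n * f i (- s n + t) - y t) powr p) \<le> ennreal (b powr p) * indicator (D - K n) t"
          using y[of t] p by (cases "t \<in> D") (auto intro!: ennreal_leI powr_mono2)
        then show ?thesis by (rule order_trans) simp
      qed
    qed
    also have "\<dots> = ennreal (b powr p) * emeasure \<nu> (D - K n) + (\<Sum>j. c j * emeasure \<nu> (T n (r j)))"
      by (simp add: nn_integral_add nn_integral_cmult nn_integral_suminf)
    also have "(\<Sum>j. c j * emeasure \<nu> (T n (r j))) = Rs n"
      unfolding Rs_def by (intro suminf_cong) (simp add: c_def a mult.assoc)
    finally show ?thesis .
  qed
  have fL: "f i \<in> L" if i: "i \<in> {1..N}" for i
  proof -
    have "(\<integral>\<^sup>+t. ennreal (norm (l 0 * f i (- s 0 + t) - 0) powr p) \<partial>\<nu>) \<le> ennreal (0 powr p) * emeasure \<nu> ({} - K 0) + Rs 0"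
    proof (rule estimate[OF i])
      show "(\<lambda>t. 0) = \<phi> j i" if "0 = r j" for j using r(2)[of j] that by simp
    qed (simp_all add: h0)
    also have "\<dots> < \<infinity>" using Rs0 by simp
    finally show ?thesis using h0 by (simp add: Lp_iff_nn)
  qed
  have conv: "eventually (\<lambda>j. \<forall>i\<in>{1..N}. nrm (\<lambda>t. l (r j) * left_translate (s (r j)) (f i) t - \<phi> j i t) < e) sequentially"
    if e: "e > 0" for e
  proof -
    have "(\<lambda>j. ennreal ((1/2)^j) + Rs (r j)) \<longlonglongrightarrow> ennreal 0 + 0"
      by (intro tendsto_add tendsto_ennrealI Rs_lim LIMSEQ_power_zero) simp
    then have "eventually (\<lambda>j. ennreal ((1/2)^j) + Rs (r j) < ennreal (e powr p)) sequentially"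
      using e by (intro order_tendstoD(2)) auto
    then show ?thesis
    proof eventually_elim
      case (elim j)
      show ?case
      proof
        fix i assume i: "i \<in> {1..N}"
        have \<nu>: "emeasure \<nu> (F (r j) - K (r j)) < ennreal ((1/2)^(r j))"
          by (rule \<delta>(2)) (use FK[OF r(2)] in auto)
        have "(\<integral>\<^sup>+t. ennreal (norm (l (r j) * f i (- s (r j) + t) - \<phi> j i t) powr p) \<partial>\<nu>)
            \<le> ennreal (B j powr p) * emeasure \<nu> (F (r j) - K (r j)) + Rs (r j)"
        proof (rule estimate[OF i F B[OF i] \<phi>_supp[OF i r(3)]])
          show "\<phi> j i = \<phi> j' i" if "r j = r j'" for j' using that r_inj by simp
          show "F (r j) \<inter> T (r j) (r j') = {}" if "r j \<noteq> r j'" for j'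
          proof -
            have d: "(\<lambda>t. - s (r j) + t) ` F (r j) \<inter> (\<lambda>t. - s (r j') + t) ` F (r j') = {}"
              using dis r(2) that unfolding disjoint_family_on_def by auto
            have False if t: "t \<in> F (r j)" "t \<in> T (r j) (r j')" for t
            proof -
              have "- s (r j) + t \<in> (\<lambda>t. - s (r j) + t) ` F (r j)" using t by blast
              moreover have "- s (r j) + t \<in> (\<lambda>t. - s (r j') + t) ` F (r j')"
                using t(2) h1[OF r(2)[of j']] unfolding T_iff translate_image[of "- s (r j')"] by auto
              ultimately show False using d by blast
            qed
            then show ?thesis by blast
          qed
          have "K (r j) = T (r j) (r j)" by (auto simp: T_iff)
          then show "K (r j) \<subseteq> (\<Union>j'. T (r j) (r j'))" by blast
        qed
        also have "\<dots> \<le> ennreal (B j powr p) * ennreal ((1/2)^(r j)) + Rs (r j)"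
          using \<nu> by (intro add_right_mono mult_left_mono) auto
        also have "ennreal (B j powr p) * ennreal ((1/2)^(r j)) = ennreal (B j powr p * (1/2)^(r j))"
          by (rule ennreal_mult'[symmetric]) simp
        also have "\<dots> + Rs (r j) \<le> ennreal ((1/2)^j) + Rs (r j)"
          by (intro add_right_mono ennreal_leI less_imp_le r(5))
        also note elim
        finally show "nrm (\<lambda>t. l (r j) * left_translate (s (r j)) (f i) t - \<phi> j i t) < e"
          by (intro Lp_norm_lessI(2) e) (auto simp: left_translate_def)
      qed
    qed
  qed
  have "dense_tuple \<mu> p \<omega> \<Gamma> S N f"
  proof (rule dense_tupleI[OF fL])
    fix g and e :: real assume g: "\<And>i. i \<in> {1..N} \<Longrightarrow> g i \<in> L" and e: "e > 0"
    have "\<exists>m. nrm (\<lambda>t. g i t - \<psi> m t) < e/2" if "i \<in> {1..N}" for i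
      using \<psi>(3)[OF g[OF that], of "e/2"] e by simp
    then obtain m where m: "\<And>i. i \<in> {1..N} \<Longrightarrow> nrm (\<lambda>t. g i t - \<psi> (m i) t) < e/2" by metis
    obtain J where J: "\<And>j. j \<ge> J \<Longrightarrow>
        \<forall>i\<in>{1..N}. nrm (\<lambda>t. l (r j) * left_translate (s (r j)) (f i) t - \<phi> j i t) < e/2"
      using conv[of "e/2"] e unfolding eventually_sequentially by auto
    \<comment> \<open>List position 0 is filler because coordinates start at 1; the free component
      \<open>q\<close> yields infinitely many codes of the same tuple, hence one beyond
      \<open>J\<close>.\<close>
    let ?c = "\<lambda>q. to_nat (map m [0..<Suc N], q :: nat)"
    have "infinite (range ?c)" by (rule range_inj_infinite) (auto intro!: injI)
    then obtain q where q: "?c q \<ge> J"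
      unfolding infinite_nat_iff_unbounded_le by blast
    define j where "j = ?c q"
    have \<phi>j: "\<phi> j i = \<psi> (m i)" if "i \<in> {1..N}" for i
      using that by (simp add: \<phi>_def pick_def j_def nth_append nth_map_upt del: upt_Suc)
    have "nrm (\<lambda>t. l (r j) * left_translate (s (r j)) (f i) t - g i t) < e" if i: "i \<in> {1..N}" for i
    proof -
      have L: "(\<lambda>t. l (r j) * left_translate (s (r j)) (f i) t) \<in> L"
        using h1[OF r(2)] by (intro translate_in_Lp fL i) blast
      have \<psi>L: "\<psi> (m i) \<in> L"
        using bounded_compact_support_in_Lp[OF \<psi>(1) E(1)] B0 by metis
      have "nrm (\<lambda>t. (l (r j) * left_translate (s (r j)) (f i) t - \<phi> j i t) + (-1) * (g i t - \<psi> (m i) t))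
          \<le> nrm (\<lambda>t. l (r j) * left_translate (s (r j)) (f i) t - \<phi> j i t) + nrm (\<lambda>t. (-1) * (g i t - \<psi> (m i) t))"
        using \<psi>L by (intro Lp_norm_triangle Lp_funs_cmult Lp_funs_diff L g i) (simp_all add: \<phi>j[OF i])
      also have "\<dots> < e"
        using J[of j] q m[OF i] i by (subst Lp_norm_cmult) (force simp: j_def)
      finally show ?thesis by (simp add: \<phi>j[OF i])
    qed
    then show "\<exists>c\<in>\<Gamma>. \<exists>s\<in>S. \<forall>i\<in>{1..N}. nrm (\<lambda>t. c * left_translate s (f i) t - g i t) < e"
      using h1[OF r(2)[of j]] by blast
  qed
  then show ?thesis by blast
qed

end

theorem theoremA:
  fixes \<mu> :: "'a::{topological_group_add, t2_space, second_countable_topology} measure"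
    and S :: "'a set" and p :: real and \<Gamma> :: "complex set" and \<omega> :: "'a \<Rightarrow> real"
  assumes "locally_compact_space (euclidean :: 'a topology)"
    and "\<not> compact (UNIV :: 'a set)"
    and "left_Haar_measure \<mu>"
    and "1 \<le> p"
    and "\<Gamma> - {0} \<noteq> {}"
    and "weight \<mu> \<omega>"
    and "locally_p_integrable \<mu> p \<omega>"
    and "admissible \<mu> S \<omega>"
  shows "((\<exists>f. dense_vector \<mu> p \<omega> \<Gamma> S f) \<longleftrightarrow>
      (\<forall>(F :: nat \<Rightarrow> 'a set) (\<delta> :: nat \<Rightarrow> real).
        (\<forall>n\<ge>1. compact (F n) \<and> emeasure \<mu> (F n) > 0 \<and> F n \<subseteq> F (Suc n)) \<and>
        (\<forall>n\<ge>1. \<delta> n > 0) \<longrightarrow>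
        (\<exists>(s :: nat \<Rightarrow> 'a) (l :: nat \<Rightarrow> complex) (K :: nat \<Rightarrow> 'a set).
          s 0 = 0 \<and> l 0 = 1 \<and> K 0 = {} \<and>
          (\<forall>n\<ge>1. s n \<in> S \<and> l n \<in> \<Gamma> - {0} \<and> compact (K n) \<and> K n \<subseteq> F n) \<and>
          disjoint_family_on (\<lambda>n. (\<lambda>t. - s n + t) ` F n) {1..} \<and>
          (\<forall>n\<ge>1. emeasure \<mu> (F n - K n) < ennreal (\<delta> n)) \<and>
          (\<lambda>(n, k). norm (l n) powr p / norm (l k) powr p
              * norm_on \<mu> p ((\<lambda>t. s n - s k + t) ` K k) \<omega> powr p)
            summable_on {(n, k). n \<noteq> k})))
    \<and> ((\<exists>f. dense_vector \<mu> p \<omega> \<Gamma> S f) \<longleftrightarrow> (\<forall>N\<ge>1. \<exists>f. dense_tuple \<mu> p \<omega> \<Gamma> S N f))"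
    (is "(?dense \<longleftrightarrow> ?summable) \<and> (?dense \<longleftrightarrow> ?tuples)")
proof -
  interpret weighted_lc_group \<mu> p \<omega> S \<Gamma> by unfold_locales (fact assms)+
  have 1: ?summable if dense: ?dense
  proof (intro allI impI)
    fix F :: "nat \<Rightarrow> 'a set" and \<delta> :: "nat \<Rightarrow> real"
    assume *: "(\<forall>n\<ge>1. compact (F n) \<and> emeasure \<mu> (F n) > 0 \<and> F n \<subseteq> F (Suc n)) \<and> (\<forall>n\<ge>1. \<delta> n > 0)"
    obtain f where f: "dense_vector \<mu> p \<omega> \<Gamma> S f" using dense by (rule exE)
    show "\<exists>(s :: nat \<Rightarrow> 'a) (l :: nat \<Rightarrow> complex) (K :: nat \<Rightarrow> 'a set).
          s 0 = 0 \<and> l 0 = 1 \<and> K 0 = {} \<and>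
          (\<forall>n\<ge>1. s n \<in> S \<and> l n \<in> \<Gamma> - {0} \<and> compact (K n) \<and> K n \<subseteq> F n) \<and>
          disjoint_family_on (\<lambda>n. (\<lambda>t. - s n + t) ` F n) {1..} \<and>
          (\<forall>n\<ge>1. emeasure \<mu> (F n - K n) < ennreal (\<delta> n)) \<and>
          (\<lambda>(n, k). norm (l n) powr p / norm (l k) powr p
              * norm_on \<mu> p ((\<lambda>t. s n - s k + t) ` K k) \<omega> powr p)
            summable_on {(n, k). n \<noteq> k}"
      by (rule dense_vector_imp_summable[OF f]) (use * in simp_all)
  qed
  have 2: ?tuples if ?summable
    by (intro allI impI summable_imp_dense_tuple) (rule that[THEN spec, THEN spec, THEN mp])
  have 3: ?dense if tuples: ?tuples
  proof -
    obtain f where "dense_tuple \<mu> p \<omega> \<Gamma> S 1 f" using tuples[rule_format, of 1] by auto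
    then have "dense_vector \<mu> p \<omega> \<Gamma> S (f 1)" by (rule dense_tuple_imp_dense_vector) simp
    then show ?dense by (intro exI[of _ "f 1"])
  qed
  show ?thesis
  proof (intro conjI iffI)
    show ?summable if ?dense using that by (rule 1)
    show ?dense if ?summable using 2[OF that] by (rule 3)
    show ?tuples if ?dense using 1[OF that] by (rule 2)
    show ?dense if ?tuples using that by (rule 3)
  qed
qed

end
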